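(* Let $N\ge 1$ be an integer and let $G\in\{S_N,A_N,D_N,C_N,E_N\}$, regarded as a permutation group on $\{1,\dots,N\}$. The dimension of the real Lie algebra $G\mathfrak{su}(2^N)$ is $$\dim_{\mathbb{R}} G\mathfrak{su}(2^N) = Z[G](4,\ldots,4)-1,$$ that is, all variables $a_i$ are set equal to $4$, where the polynomials $Z[G]$ in the variables $\{a_i\}_{i\ge1}$ (the cycle index polynomials) are given by $$Z[S_N](\{a_i\}) = \frac1N\sum_{l=1}^N a_l\, Z[S_{N-l}](\{a_i\}),\qquad Z[S_0]:=1,$$ $$Z[A_N](\{a_i\}) = Z[S_N](\{a_i\}) + Z[S_N](\{(-1)^{i-1}a_i\}),$$ $$Z[D_N](\{a_i\}) = \begin{cases}\frac12 Z[C_N](\{a_i\})+\frac14\left(a_1^2a_2^{\frac{N-2}{2}}+a_2^{\frac N2}\right) & N \text{ even},\\[4pt] \frac12 Z[C_N](\{a_i\})+\frac12 a_1a_2^{\frac{N-1}{2}} & N\text{ odd},\end{cases}$$ $$Z[C_N](\{a_i\}) = \frac1N\sum_{d\mid N}\phi(d)\,a_d^{N/d},\qquad Z[E_N](\{a_i\})=a_1^N,$$ with $\phi$ Euler's totient function.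
   Context: $S_N$ is the symmetric group on $\{1,\dots,N\}$; $A_N$ is its subgroup of even permutations; $D_N$ is the dihedral group acting on the $N$ vertices of a regular $N$-gon (as permutations of the vertices, i.e. rotations and reflections); $C_N$ is the cyclic group acting by cyclic rotations of $\{1,\dots,N\}$; $E_N$ is the trivial group acting on $\{1,\dots,N\}$. $\mathfrak{su}(2^N)$ is the real Lie algebra of traceless skew-Hermitian $2^N\times2^N$ complex matrices. With $\sigma_0$ the $2\times2$ identity and $\sigma_1,\sigma_2,\sigma_3$ the Pauli matrices, a real basis of it consists of the matrices $i\,\sigma_{\mu_1}\otimes\cdots\otimes\sigma_{\mu_N}$, $(\mu_1,\dots,\mu_N)\in\{0,1,2,3\}^N\setminus\{(0,\dots,0)\}$ ($\otimes$ the Kronecker product). A permutation $\alpha$ of $\{1,\dots,N\}$ acts linearly on $\mathfrak{su}(2^N)$ by $\rho(\alpha,\, i\sigma_{\mu_1}\otimes\cdots\otimes\sigma_{\mu_N}) = i\sigma_{\mu_{\alpha(1)}}\otimes\cdots\otimes\sigma_{\mu_{\alpha(N)}}$. For a permutation group $G\le S_N$, $G\mathfrak{su}(2^N):=\{a\in\mathfrak{su}(2^N):\rho(\alpha,a)=a\ \text{for all }\alpha\in G\}$.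
   Formalization: The formula for A_N is stated only for N ≥ 2: for N = 1 the group A_1 is trivial and the dimension is 3, while Z[A_1](4) − 1 = 7, so the printed claim fails there; the other four groups are covered for all N ≥ 1. *)

theory Defs
  imports
    "HOL-Algebra.Sym_Groups"
    "HOL-Number_Theory.Totient"
    "Jordan_Normal_Form.VS_Connect"
    "Jordan_Normal_Form.Schur_Decomposition"
begin

hide_const (open) Polynomial.smult

section \<open>The Lie algebra su(n)\<close>

text \<open>
  The carrier consists of complex matrices, but the scalars are real.  The multiplication of the
  record is the Lie bracket; the record field \<open>one\<close> has no meaning for a Lie algebra.
  Neither field enters the notions of linear map and dimension used below.
\<close>
definition su :: "nat \<Rightarrow> (real, complex mat) module" where
  "su n = \<lparr>
     carrier = {A \<in> carrier_mat n n. (\<Sum>i<n. A $$ (i, i)) = 0 \<and> mat_adjoint A = - A},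
     mult = (\<lambda>A B. A * B - B * A),
     one = 0\<^sub>m n n,
     zero = 0\<^sub>m n n,
     add = (+),
     smult = (\<lambda>r A. complex_of_real r \<cdot>\<^sub>m A)\<rparr>"


section \<open>Pauli strings\<close>

definition pauli :: "nat \<Rightarrow> complex mat" where
  "pauli m =
     (if m = 0 then mat_of_rows_list 2 [[1, 0], [0, 1]]
      else if m = 1 then mat_of_rows_list 2 [[0, 1], [1, 0]]
      else if m = 2 then mat_of_rows_list 2 [[0, - \<i>], [\<i>, 0]]
      else mat_of_rows_list 2 [[1, 0], [0, - 1]])"

definition kronecker :: "complex mat \<Rightarrow> complex mat \<Rightarrow> complex mat" where
  "kronecker A B =
     mat (dim_row A * dim_row B) (dim_col A * dim_col B)
       (\<lambda>(i, j). A $$ (i div dim_row B, j div dim_col B) * B $$ (i mod dim_row B, j mod dim_col B))"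

definition pauli_string :: "nat \<Rightarrow> (nat \<Rightarrow> nat) \<Rightarrow> complex mat" where
  "pauli_string N \<mu> = foldr kronecker (map (\<lambda>k. pauli (\<mu> k)) [1..<Suc N]) (1\<^sub>m 1)"

definition pauli_indices :: "nat \<Rightarrow> (nat \<Rightarrow> nat) set" where
  "pauli_indices N = ({1..N} \<rightarrow>\<^sub>E {0..3}) - {\<lambda>k\<in>{1..N}. 0}"


section \<open>Permutation action and invariants\<close>

text \<open>
  Since the matrices \<open>\<i> \<sigma>\<^sub>\<mu>\<close> form a real basis of su(2^N), the linear map selected here exists
  and is uniquely determined on the carrier.
\<close>
definition rho :: "nat \<Rightarrow> (nat \<Rightarrow> nat) \<Rightarrow> complex mat \<Rightarrow> complex mat" where
  "rho N \<alpha> =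
     (SOME f. f \<in> module_hom class_ring (su (2 ^ N)) (su (2 ^ N)) \<and>
        (\<forall>\<mu> \<in> pauli_indices N.
           f (\<i> \<cdot>\<^sub>m pauli_string N \<mu>) = \<i> \<cdot>\<^sub>m pauli_string N (\<mu> \<circ> \<alpha>)))"

definition Gsu :: "(nat \<Rightarrow> nat) set \<Rightarrow> nat \<Rightarrow> (real, complex mat) module" where
  "Gsu G N = (su (2 ^ N))\<lparr>carrier := {a \<in> carrier (su (2 ^ N)). \<forall>\<alpha>\<in>G. rho N \<alpha> a = a}\<rparr>"

abbreviation real_dim :: "(real, complex mat) module \<Rightarrow> nat" where
  "real_dim V \<equiv> vectorspace.dim class_ring V"


section \<open>The permutation groups\<close>

definition S_grp :: "nat \<Rightarrow> (nat \<Rightarrow> nat) set" where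
  "S_grp N = carrier (sym_group N)"

definition A_grp :: "nat \<Rightarrow> (nat \<Rightarrow> nat) set" where
  "A_grp N = carrier (alt_group N)"

definition rotation :: "nat \<Rightarrow> nat \<Rightarrow> nat \<Rightarrow> nat" where
  "rotation N k i = (if i \<in> {1..N} then (i - 1 + k) mod N + 1 else i)"

definition reversal :: "nat \<Rightarrow> nat \<Rightarrow> nat" where
  "reversal N i = (if i \<in> {1..N} then N + 1 - i else i)"

definition C_grp :: "nat \<Rightarrow> (nat \<Rightarrow> nat) set" where
  "C_grp N = {rotation N k | k. k < N}"

text \<open>
  The vertices of the N-gon are numbered 1, ..., N in cyclic order.  Every reflection is the
  reversal followed by a rotation.  This is a set of permutations of the vertices, so it has
  fewer than 2N elements when N is 1 or 2.
\<close>
definition D_grp :: "nat \<Rightarrow> (nat \<Rightarrow> nat) set" where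
  "D_grp N = C_grp N \<union> {rotation N k \<circ> reversal N | k. k < N}"

definition E_grp :: "nat \<Rightarrow> (nat \<Rightarrow> nat) set" where
  "E_grp N = {id}"


section \<open>Cycle index polynomials\<close>

text \<open>
  A polynomial in the variables a(1), a(2), ... is represented by its polynomial function on
  real assignments \<open>a\<close>; the value \<open>a 0\<close> is never used.
\<close>

context
  notes sum.cong [fundef_cong]
begin

fun Z_S :: "nat \<Rightarrow> (nat \<Rightarrow> real) \<Rightarrow> real" where
  "Z_S N a = (if N = 0 then 1 else 1 / real N * (\<Sum>l = 1..N. a l * Z_S (N - l) a))"

end

declare Z_S.simps [simp del]

text \<open>
  This formula presupposes that A_N has index 2 in S_N, i.e. that N is at least 2; for N = 1 it
  yields 2 a(1), although A_1 is trivial.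
\<close>
definition Z_A :: "nat \<Rightarrow> (nat \<Rightarrow> real) \<Rightarrow> real" where
  "Z_A N a = Z_S N a + Z_S N (\<lambda>i. (- 1) ^ (i - 1) * a i)"

definition Z_C :: "nat \<Rightarrow> (nat \<Rightarrow> real) \<Rightarrow> real" where
  "Z_C N a = 1 / real N * (\<Sum>d | d dvd N. real (totient d) * a d ^ (N div d))"

definition Z_D :: "nat \<Rightarrow> (nat \<Rightarrow> real) \<Rightarrow> real" where
  "Z_D N a =
     (if even N
      then 1 / 2 * Z_C N a + 1 / 4 * ((a 1)\<^sup>2 * a 2 ^ ((N - 2) div 2) + a 2 ^ (N div 2))
      else 1 / 2 * Z_C N a + 1 / 2 * (a 1 * a 2 ^ ((N - 1) div 2)))"

definition Z_E :: "nat \<Rightarrow> (nat \<Rightarrow> real) \<Rightarrow> real" where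
  "Z_E N a = a 1 ^ N"

end

theory Submission
  imports Defs
begin

text \<open>
  In the Pauli basis the coefficient of \<open>\<i> \<sigma>\<^sub>\<mu>\<close> in \<open>A\<close> is \<open>Im (tr (\<sigma>\<^sub>\<mu> A)) / 2 ^ N\<close>, and \<open>A\<close> is invariant under
  \<open>G\<close> iff its coefficients are constant on the orbits of \<open>G\<close> on the nonzero indices \<open>\<mu>\<close>.  Hence the
  dimension is the number of orbits of \<open>G\<close> on all maps \<open>{1..N} \<rightarrow> {0..3}\<close>, minus one for the zero index.

  For \<open>S\<^sub>N\<close> the orbits are the multisets of size \<open>N\<close> over four letters, so there are \<open>(N + 3) choose 3\<close>,
  which satisfies the recursion of the cycle index.  A stabilizer in \<open>A\<^sub>N\<close> has index 2 in the stabilizer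
  in \<open>S\<^sub>N\<close> unless \<open>\<mu>\<close> is injective, when both are trivial; counting by stabilizers, \<open>A\<^sub>N\<close> has
  \<open>4 choose N\<close> further orbits, one for each \<open>S\<^sub>N\<close>-orbit of injective maps.  For the remaining groups
  Burnside's lemma applies: a rotation by \<open>k\<close> fixes \<open>4 ^ gcd k N\<close> maps, and an involution with \<open>f\<close> fixed
  points fixes \<open>4 ^ ((N + f) / 2)\<close> of them.
\<close>

declare One_nat_def [simp del]

section \<open>Orbits of permutation groups on maps\<close>

abbreviation all_indices :: "nat \<Rightarrow> (nat \<Rightarrow> nat) set" where
  "all_indices N \<equiv> {1..N} \<rightarrow>\<^sub>E {0..3}"

abbreviation zero_index :: "nat \<Rightarrow> nat \<Rightarrow> nat" where
  "zero_index N \<equiv> \<lambda>k\<in>{1..N}. 0"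

lemma finite_all_indices: "finite (all_indices N)"
  by (intro finite_PiE) auto

lemma zero_index_in: "zero_index N \<in> all_indices N"
  by auto

lemma finite_pauli_indices: "finite (pauli_indices N)"
  unfolding pauli_indices_def using finite_all_indices by blast

lemma PiE_comp_permutes: "\<mu> \<in> X \<rightarrow>\<^sub>E Y \<Longrightarrow> \<alpha> permutes X \<Longrightarrow> \<mu> \<circ> \<alpha> \<in> X \<rightarrow>\<^sub>E Y"
  by (auto simp: PiE_iff extensional_def permutes_in_image permutes_not_in)

lemma zero_index_comp_permutes: "\<alpha> permutes {1..N} \<Longrightarrow> zero_index N \<circ> \<alpha> = zero_index N"
  by (rule ext) (auto simp: restrict_def permutes_in_image simp del: atLeastAtMost_iff)

lemma comp_permutes_eq_iff:
  assumes "\<alpha> permutes X"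
  shows "\<mu> \<circ> inv' \<alpha> = \<nu> \<longleftrightarrow> \<mu> = \<nu> \<circ> \<alpha>"
  using permutes_inv_o[OF assms] by (metis comp_assoc comp_id)

lemma pauli_indices_comp_permutes:
  assumes "\<mu> \<in> pauli_indices N" "\<alpha> permutes {1..N}"
  shows "\<mu> \<circ> \<alpha> \<in> pauli_indices N"
proof -
  have "\<mu> \<circ> \<alpha> \<noteq> zero_index N"
  proof
    assume "\<mu> \<circ> \<alpha> = zero_index N"
    then have "\<mu> = zero_index N \<circ> inv' \<alpha>" using comp_permutes_eq_iff[OF assms(2)] by metis
    then have "\<mu> = zero_index N"
      using zero_index_comp_permutes[OF permutes_inv[OF assms(2)]] by simp
    then show False using assms(1) by (simp add: pauli_indices_def)
  qed
  then show ?thesis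
    using assms PiE_comp_permutes[of \<mu> "{1..N}" "{0..3}" \<alpha>] by (simp add: pauli_indices_def)
qed

section \<open>Permutation groups and orbit counting\<close>

locale perm_group =
  fixes X :: "'a set" and G :: "('a \<Rightarrow> 'a) set"
  assumes permutes: "g \<in> G \<Longrightarrow> g permutes X"
    and id_in: "id \<in> G"
    and comp_in: "g \<in> G \<Longrightarrow> h \<in> G \<Longrightarrow> g \<circ> h \<in> G"
    and inv_in: "g \<in> G \<Longrightarrow> inv' g \<in> G"

text \<open>Composition on the right is how \<open>rho\<close> moves the index of a Pauli string.
  Both ends are confined to \<Omega>, so the relation is an equivalence on any \<Omega>, in
  particular on all indices and on the nonzero ones.\<close>

definition orbit_rel :: "('a \<Rightarrow> 'a) set \<Rightarrow> ('a \<Rightarrow> 'b) set \<Rightarrow> (('a \<Rightarrow> 'b) \<times> ('a \<Rightarrow> 'b)) set" where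
  "orbit_rel G \<Omega> = {(\<mu>, \<nu>). \<mu> \<in> \<Omega> \<and> \<nu> \<in> \<Omega> \<and> (\<exists>g\<in>G. \<nu> = \<mu> \<circ> g)}"

lemma (in perm_group) equiv_orbit_rel: "equiv \<Omega> (orbit_rel G \<Omega>)"
proof (rule equivI)
  show "orbit_rel G \<Omega> \<subseteq> \<Omega> \<times> \<Omega>" by (auto simp: orbit_rel_def)
  show "refl_on \<Omega> (orbit_rel G \<Omega>)"
    using id_in by (auto simp: orbit_rel_def refl_on_def intro!: bexI[of _ id])
  show "sym (orbit_rel G \<Omega>)"
  proof (rule symI)
    fix \<mu> \<nu> assume "(\<mu>, \<nu>) \<in> orbit_rel G \<Omega>"
    then obtain g where g: "g \<in> G" "\<nu> = \<mu> \<circ> g" "\<mu> \<in> \<Omega>" "\<nu> \<in> \<Omega>" by (auto simp: orbit_rel_def)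
    then have "\<mu> = \<nu> \<circ> inv' g" using comp_permutes_eq_iff[OF permutes[OF g(1)]] by metis
    then show "(\<nu>, \<mu>) \<in> orbit_rel G \<Omega>" using g inv_in by (auto simp: orbit_rel_def)
  qed
  show "trans (orbit_rel G \<Omega>)"
  proof (rule transI)
    fix \<mu> \<nu> \<xi> assume "(\<mu>, \<nu>) \<in> orbit_rel G \<Omega>" "(\<nu>, \<xi>) \<in> orbit_rel G \<Omega>"
    then obtain g h where "g \<in> G" "h \<in> G" "\<nu> = \<mu> \<circ> g" "\<xi> = \<nu> \<circ> h" "\<mu> \<in> \<Omega>" "\<xi> \<in> \<Omega>"
      by (auto simp: orbit_rel_def)
    then show "(\<mu>, \<xi>) \<in> orbit_rel G \<Omega>"
      using comp_in[of g h] by (auto simp: orbit_rel_def comp_assoc)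
  qed
qed

text \<open>For \<nu> = \<mu> \<circ> h, composing with h on the left carries the stabilizer of
  \<nu> bijectively onto the set of group elements sending \<mu> to \<nu>. As \<nu> runs through the
  orbit, these sets partition G.\<close>

lemma (in perm_group) orbit_sum_stabilizers:
  assumes fin: "finite G" "finite \<Omega>" and \<mu>: "\<mu> \<in> \<Omega>"
    and closed: "\<And>\<nu> g. \<nu> \<in> \<Omega> \<Longrightarrow> g \<in> G \<Longrightarrow> \<nu> \<circ> g \<in> \<Omega>"
  shows "(\<Sum>\<nu>\<in>orbit_rel G \<Omega> `` {\<mu>}. card {g \<in> G. \<nu> \<circ> g = \<nu>}) = card G"
proof -
  let ?K = "orbit_rel G \<Omega> `` {\<mu>}"
  have "card {g \<in> G. \<nu> \<circ> g = \<nu>} = card {g \<in> G. \<mu> \<circ> g = \<nu>}" if "\<nu> \<in> ?K" for \<nu>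
  proof -
    from that obtain h where h: "h \<in> G" "\<nu> = \<mu> \<circ> h" by (auto simp: orbit_rel_def)
    have "bij_betw ((\<circ>) h) {g \<in> G. \<nu> \<circ> g = \<nu>} {g \<in> G. \<mu> \<circ> g = \<nu>}"
    proof (rule bij_betw_byWitness[where f' = "(\<circ>) (inv' h)"])
      have *: "h \<circ> (inv' h \<circ> g) = g" "inv' h \<circ> (h \<circ> g) = g" for g
        using permutes_inv_o[OF permutes[OF h(1)]] by (simp_all add: comp_assoc[symmetric])
      show "\<forall>g\<in>{g \<in> G. \<nu> \<circ> g = \<nu>}. inv' h \<circ> (h \<circ> g) = g" using * by blast
      show "\<forall>g\<in>{g \<in> G. \<mu> \<circ> g = \<nu>}. h \<circ> (inv' h \<circ> g) = g" using * by blast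
      show "(\<circ>) h ` {g \<in> G. \<nu> \<circ> g = \<nu>} \<subseteq> {g \<in> G. \<mu> \<circ> g = \<nu>}"
        using h comp_in by (auto simp: comp_assoc)
      show "(\<circ>) (inv' h) ` {g \<in> G. \<mu> \<circ> g = \<nu>} \<subseteq> {g \<in> G. \<nu> \<circ> g = \<nu>}"
        using h comp_in inv_in by (auto simp: comp_assoc *)
    qed
    then show ?thesis by (rule bij_betw_same_card)
  qed
  then have "(\<Sum>\<nu>\<in>?K. card {g \<in> G. \<nu> \<circ> g = \<nu>}) = (\<Sum>\<nu>\<in>?K. \<Sum>g\<in>{g \<in> G. \<mu> \<circ> g = \<nu>}. 1)"
    by simp
  also have "\<dots> = (\<Sum>g\<in>G. 1)"
  proof (rule sum.group)
    show "finite ?K" using fin by (auto simp: orbit_rel_def intro: finite_subset)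
  qed (use fin \<mu> closed in \<open>auto simp: orbit_rel_def\<close>)
  finally show ?thesis by simp
qed

text \<open>Every orbit contributes card G to the sum. The count by stabilizers is kept separate
  from Burnside's form because for the alternating group the stabilizers, not the fixed maps, are
  what can be compared with the symmetric group.\<close>

lemma (in perm_group) orbits_mult_card:
  assumes fin: "finite G" "finite \<Omega>"
    and closed: "\<And>\<nu> g. \<nu> \<in> \<Omega> \<Longrightarrow> g \<in> G \<Longrightarrow> \<nu> \<circ> g \<in> \<Omega>"
  shows "card (\<Omega> // orbit_rel G \<Omega>) * card G = (\<Sum>\<nu>\<in>\<Omega>. card {g \<in> G. \<nu> \<circ> g = \<nu>})"
proof -
  let ?R = "orbit_rel G \<Omega>"
  have equiv: "equiv \<Omega> ?R" by (rule equiv_orbit_rel)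
  have "(\<Sum>\<nu>\<in>\<Omega>. card {g \<in> G. \<nu> \<circ> g = \<nu>}) = (\<Sum>\<nu>\<in>\<Union>(\<Omega> // ?R). card {g \<in> G. \<nu> \<circ> g = \<nu>})"
    by (simp add: Union_quotient[OF equiv])
  also have "\<dots> = (\<Sum>K\<in>\<Omega> // ?R. \<Sum>\<nu>\<in>K. card {g \<in> G. \<nu> \<circ> g = \<nu>})"
  proof (subst sum.Union_disjoint)
    show "\<forall>K\<in>\<Omega> // ?R. finite K"
      using fin Union_quotient[OF equiv] by (metis Sup_upper finite_subset)
    show "\<forall>K\<in>\<Omega> // ?R. \<forall>L\<in>\<Omega> // ?R. K \<noteq> L \<longrightarrow> K \<inter> L = {}"
      using quotient_disj[OF equiv] by blast
  qed simp
  also have "\<dots> = (\<Sum>K\<in>\<Omega> // ?R. card G)"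
    by (intro sum.cong refl) (auto elim!: quotientE simp: orbit_sum_stabilizers[OF fin _ closed])
  finally show ?thesis by simp
qed

text \<open>Double counting of the pairs of g and \<nu> with \<nu> \<circ> g = \<nu>.\<close>

lemma (in perm_group) burnside:
  assumes fin: "finite G" "finite \<Omega>"
    and closed: "\<And>\<nu> g. \<nu> \<in> \<Omega> \<Longrightarrow> g \<in> G \<Longrightarrow> \<nu> \<circ> g \<in> \<Omega>"
  shows "card (\<Omega> // orbit_rel G \<Omega>) * card G = (\<Sum>g\<in>G. card {\<nu> \<in> \<Omega>. \<nu> \<circ> g = \<nu>})"
proof -
  have "(\<Sum>\<nu>\<in>\<Omega>. card {g \<in> G. \<nu> \<circ> g = \<nu>}) = (\<Sum>\<nu>\<in>\<Omega>. \<Sum>g\<in>G. if \<nu> \<circ> g = \<nu> then 1 else 0)"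
    using fin by (simp add: sum.If_cases Int_def)
  also have "\<dots> = (\<Sum>g\<in>G. \<Sum>\<nu>\<in>\<Omega>. if \<nu> \<circ> g = \<nu> then 1 else 0)" by (rule sum.swap)
  also have "\<dots> = (\<Sum>g\<in>G. card {\<nu> \<in> \<Omega>. \<nu> \<circ> g = \<nu>})"
    using fin by (simp add: sum.If_cases Int_def)
  finally show ?thesis using orbits_mult_card[OF assms] by simp
qed

text \<open>Every permutation of the positions fixes the zero index, which is therefore an orbit by
  itself, while nonzero indices stay nonzero. This is the source of the -1 in the dimension
  formula.\<close>

lemma card_orbits_nonzero:
  assumes "perm_group {1..N} G"
  shows "card (all_indices N // orbit_rel G (all_indices N))
    = card (pauli_indices N // orbit_rel G (pauli_indices N)) + 1"
proof -
  interpret perm_group "{1..N}" G by fact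
  let ?R = "orbit_rel G (all_indices N)" and ?R' = "orbit_rel G (pauli_indices N)"
  have sub: "pauli_indices N \<subseteq> all_indices N" by (auto simp: pauli_indices_def)
  have all: "all_indices N = insert (zero_index N) (pauli_indices N)"
    using zero_index_in by (auto simp: pauli_indices_def)
  have "?R `` {zero_index N} = {zero_index N}"
    using zero_index_comp_permutes permutes id_in zero_index_in[of N]
    by (fastforce simp: orbit_rel_def)
  moreover have "?R `` {\<mu>} = ?R' `` {\<mu>}" if "\<mu> \<in> pauli_indices N" for \<mu>
    using that sub pauli_indices_comp_permutes permutes by (fastforce simp: orbit_rel_def)
  ultimately have quot: "all_indices N // ?R = insert {zero_index N} (pauli_indices N // ?R')"
    unfolding quotient_def all by auto
  have "zero_index N \<notin> K" if "K \<in> pauli_indices N // ?R'" for K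
    using in_quotient_imp_subset[OF equiv_orbit_rel that] by (auto simp: pauli_indices_def)
  then have "{zero_index N} \<notin> pauli_indices N // ?R'" by blast
  moreover have "finite (pauli_indices N // ?R')"
    using finite_pauli_indices equiv_orbit_rel by (intro finite_quotient) (auto simp: equiv_def)
  ultimately show ?thesis unfolding quot by simp
qed

section \<open>Maps fixed by a permutation\<close>

lemma card_PiE_retract:
  assumes "finite T" "T \<subseteq> X" "\<And>x. x \<in> X \<Longrightarrow> r x \<in> T" "\<And>x. x \<in> T \<Longrightarrow> r x = x"
  shows "card {\<mu> \<in> X \<rightarrow>\<^sub>E Q. \<forall>x\<in>X. \<mu> x = \<mu> (r x)} = card Q ^ card T"
proof -
  \<comment> \<open>A map that agrees with its pullback along r amounts to a free choice of values
    on T; the inverse extends such a choice by composing with r. In the applications T picks one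
    point from each cycle.\<close>
  have "bij_betw (\<lambda>\<mu>. restrict \<mu> T) {\<mu> \<in> X \<rightarrow>\<^sub>E Q. \<forall>x\<in>X. \<mu> x = \<mu> (r x)} (T \<rightarrow>\<^sub>E Q)"
  proof (rule bij_betw_byWitness[where f' = "\<lambda>\<nu>. \<lambda>x\<in>X. \<nu> (r x)"])
    show "\<forall>\<mu>\<in>{\<mu> \<in> X \<rightarrow>\<^sub>E Q. \<forall>x\<in>X. \<mu> x = \<mu> (r x)}. (\<lambda>x\<in>X. restrict \<mu> T (r x)) = \<mu>"
      using assms by (fastforce intro!: ext simp: restrict_def PiE_iff extensional_def)
    show "\<forall>\<nu>\<in>T \<rightarrow>\<^sub>E Q. restrict (\<lambda>x\<in>X. \<nu> (r x)) T = \<nu>"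
      using assms by (fastforce intro!: ext simp: restrict_def PiE_iff extensional_def)
    show "(\<lambda>\<mu>. restrict \<mu> T) ` {\<mu> \<in> X \<rightarrow>\<^sub>E Q. \<forall>x\<in>X. \<mu> x = \<mu> (r x)} \<subseteq> T \<rightarrow>\<^sub>E Q"
      using assms by auto
    show "(\<lambda>\<nu>. \<lambda>x\<in>X. \<nu> (r x)) ` (T \<rightarrow>\<^sub>E Q) \<subseteq> {\<mu> \<in> X \<rightarrow>\<^sub>E Q. \<forall>x\<in>X. \<mu> x = \<mu> (r x)}"
      using assms by (auto simp: subset_iff PiE_iff)
  qed
  then show ?thesis
    using card_funcsetE[OF assms(1), of Q] by (simp add: bij_betw_same_card)
qed

lemma comp_permutes_fixed_iff:
  assumes "\<mu> \<in> X \<rightarrow>\<^sub>E Q" "g permutes X"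
  shows "\<mu> \<circ> g = \<mu> \<longleftrightarrow> (\<forall>x\<in>X. \<mu> (g x) = \<mu> x)"
  using assms PiE_comp_permutes[OF assms] by (auto simp: fun_eq_iff intro: PiE_ext) (metis permutes_not_in)

text \<open>Each cycle {x, g x} is represented by its smaller element, so t is the number of points
  with x \<le> g x. The involution exchanges these with the points where g x \<le> x; the two sets
  cover X and meet exactly in the fixed points, which yields the formula for 2 * t.\<close>

lemma card_fixed_involution:
  fixes X :: "'a::linorder set"
  assumes "finite X" "g permutes X" "\<And>x. g (g x) = x"
  shows "\<exists>t. card {\<mu> \<in> X \<rightarrow>\<^sub>E Q. \<mu> \<circ> g = \<mu>} = card Q ^ t \<and> 2 * t = card X + card {x \<in> X. g x = x}"
proof -
  let ?T = "{x \<in> X. x \<le> g x}" and ?U = "{x \<in> X. g x \<le> x}"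
  have X: "g x \<in> X \<longleftrightarrow> x \<in> X" for x using assms(2) by (rule permutes_in_image)
  have "(\<mu> \<circ> g = \<mu>) \<longleftrightarrow> (\<forall>x\<in>X. \<mu> x = \<mu> (min x (g x)))" if "\<mu> \<in> X \<rightarrow>\<^sub>E Q" for \<mu>
    unfolding comp_permutes_fixed_iff[OF that assms(2)]
    by (metis X assms(3) min.commute min_def)
  then have "{\<mu> \<in> X \<rightarrow>\<^sub>E Q. \<mu> \<circ> g = \<mu>} = {\<mu> \<in> X \<rightarrow>\<^sub>E Q. \<forall>x\<in>X. \<mu> x = \<mu> (min x (g x))}"
    by blast
  then have "card {\<mu> \<in> X \<rightarrow>\<^sub>E Q. \<mu> \<circ> g = \<mu>} = card Q ^ card ?T"
    by (simp only:, intro card_PiE_retract) (use assms X in \<open>auto simp: min_def\<close>)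
  moreover have "bij_betw g ?T ?U"
    by (rule bij_betw_byWitness[where f' = g]) (use assms(3) X in auto)
  then have "card ?T = card ?U" by (rule bij_betw_same_card)
  then have "2 * card ?T = card (?T \<union> ?U) + card (?T \<inter> ?U)"
    using card_Un_Int[of ?T ?U] assms(1) by simp
  moreover have "?T \<union> ?U = X" "?T \<inter> ?U = {x \<in> X. g x = x}" by auto
  ultimately show ?thesis by auto
qed

section \<open>Orbits of the symmetric group\<close>

lemma card_multisets_of_size:
  "finite A \<Longrightarrow> card (multisets_of_size A n) = (card A + n - 1) choose n"
proof (induction A arbitrary: n rule: finite_induct)
  case empty
  then show ?case by (cases "n = 0") auto
next
  case (insert a A)
  have fin: "finite (multisets_of_size A m)" for m
  proof -
    have "multisets_of_size A m \<subseteq> mset ` {xs. set xs \<subseteq> A \<and> length xs = m}"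
    proof
      fix M assume M: "M \<in> multisets_of_size A m"
      obtain xs where "mset xs = M" using ex_mset by blast
      with M show "M \<in> mset ` {xs. set xs \<subseteq> A \<and> length xs = m}"
        by (auto simp: multisets_of_size_def)
    qed
    then show ?thesis using finite_lists_length_eq[OF insert.hyps(1)] finite_surj by blast
  qed
  \<comment> \<open>Splitting by the multiplicity m of the new element a leaves a multiset of size n
    - m over A; the resulting sum is evaluated by the hockey-stick identity
    \<open>sum_choose_lower\<close>.\<close>
  have "card (multisets_of_size (insert a A) n) = (\<Sum>m\<in>{0..n}. card (multisets_of_size A (n - m)))"
    using bij_betw_same_card[OF bij_betw_multisets_of_size_insert[OF insert.hyps(2), of n]] fin
    by (simp add: card_SigmaI)
  also have "\<dots> = (\<Sum>m\<in>{0..n}. card (multisets_of_size A m))"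
    by (rule sum.atLeastAtMost_rev[of "\<lambda>m. card (multisets_of_size A m)" 0 n, simplified, symmetric])
  also have "\<dots> = (\<Sum>m\<le>n. (card A + m - 1) choose m)"
    by (simp add: insert.IH atLeast0AtMost)
  also have "\<dots> = (card A + n) choose n"
  proof (cases "card A")
    case 0
    \<comment> \<open>For empty A, truncated subtraction makes the term 1 at m = 0 and 0 at every
      other m.\<close>
    have "(\<Sum>m\<le>n. (0 + m - 1) choose m) = (\<Sum>m\<le>n. if m = 0 then 1 else 0)"
      by (intro sum.cong refl) auto
    with 0 show ?thesis by simp
  next
    case (Suc k)
    then show ?thesis using sum_choose_lower[of k n] by simp
  qed
  finally show ?case using insert by simp
qed

text \<open>The classes are the nonempty fibres of the complete invariant f.\<close>

lemma card_quotient_eq_card_image: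
  assumes equiv: "equiv \<Omega> R" and f: "\<And>x y. x \<in> \<Omega> \<Longrightarrow> y \<in> \<Omega> \<Longrightarrow> (x, y) \<in> R \<longleftrightarrow> f x = f y"
  shows "card (\<Omega> // R) = card (f ` \<Omega>)"
proof -
  have "bij_betw (\<lambda>y. {x \<in> \<Omega>. f x = y}) (f ` \<Omega>) (\<Omega> // R)"
  proof (rule bij_betw_imageI)
    show "inj_on (\<lambda>y. {x \<in> \<Omega>. f x = y}) (f ` \<Omega>)"
    proof (rule inj_onI)
      fix y z assume "y \<in> f ` \<Omega>" and eq: "{x \<in> \<Omega>. f x = y} = {x \<in> \<Omega>. f x = z}"
      then obtain x where "x \<in> {x \<in> \<Omega>. f x = y}" by auto
      with eq have "x \<in> {x \<in> \<Omega>. f x = y}" "x \<in> {x \<in> \<Omega>. f x = z}" by simp_all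
      then show "y = z" by simp
    qed
    have "R `` {x} = {y \<in> \<Omega>. f y = f x}" if "x \<in> \<Omega>" for x
    proof -
      have "(x, y) \<in> R \<longleftrightarrow> y \<in> \<Omega> \<and> f y = f x" for y
        using that f[of x y] equiv_type[OF equiv] by auto
      then show ?thesis by auto
    qed
    then have "(\<lambda>x. R `` {x}) ` \<Omega> = (\<lambda>x. {y \<in> \<Omega>. f y = f x}) ` \<Omega>" by (intro image_cong refl)
    moreover have "\<Omega> // R = (\<lambda>x. R `` {x}) ` \<Omega>" by (auto simp: quotient_def)
    ultimately show "(\<lambda>y. {x \<in> \<Omega>. f x = y}) ` f ` \<Omega> = \<Omega> // R" by (simp add: image_image)
  qed
  then show ?thesis by (simp add: bij_betw_same_card)
qed

lemma perm_group_Sym: "perm_group X {p. p permutes X}"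
  by unfold_locales (auto simp: permutes_id permutes_compose permutes_inv)

text \<open>The multiset of values is a complete invariant of a map under permutations of its
  domain, and every multiset of the right size occurs.\<close>

lemma card_orbits_Sym:
  assumes X: "finite X" and Q: "finite Q"
  shows "card ((X \<rightarrow>\<^sub>E Q) // orbit_rel {p. p permutes X} (X \<rightarrow>\<^sub>E Q)) = (card Q + card X - 1) choose card X"
proof -
  let ?\<Omega> = "X \<rightarrow>\<^sub>E Q" and ?f = "\<lambda>\<mu>. image_mset \<mu> (mset_set X)"
  interpret perm_group X "{p. p permutes X}" by (rule perm_group_Sym)
  have "card (?\<Omega> // orbit_rel {p. p permutes X} ?\<Omega>) = card (?f ` ?\<Omega>)"
  proof (rule card_quotient_eq_card_image[OF equiv_orbit_rel])
    fix \<mu> \<nu> assume \<mu>\<nu>: "\<mu> \<in> ?\<Omega>" "\<nu> \<in> ?\<Omega>"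
    show "(\<mu>, \<nu>) \<in> orbit_rel {p. p permutes X} ?\<Omega> \<longleftrightarrow> ?f \<mu> = ?f \<nu>"
    proof
      assume "(\<mu>, \<nu>) \<in> orbit_rel {p. p permutes X} ?\<Omega>"
      then obtain p where p: "p permutes X" "\<nu> = \<mu> \<circ> p" by (auto simp: orbit_rel_def)
      have "?f \<nu> = image_mset \<mu> (image_mset p (mset_set X))" by (simp add: p(2) image_mset.compositionality)
      also have "image_mset p (mset_set X) = mset_set X"
        using p(1) by (simp add: image_mset_mset_set permutes_inj_on permutes_image)
      finally show "?f \<mu> = ?f \<nu>" by simp
    next
      assume "?f \<mu> = ?f \<nu>"
      then obtain p where p: "p permutes X" "\<forall>x\<in>X. \<nu> x = \<mu> (p x)"
        using image_mset_eq_implies_permutes[OF X, of \<nu> \<mu>] by metis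
      then have "\<nu> = \<mu> \<circ> p"
        using \<mu>\<nu> PiE_comp_permutes[OF \<mu>\<nu>(1) p(1)] by (intro PiE_ext[of \<nu> X]) auto
      with p \<mu>\<nu> show "(\<mu>, \<nu>) \<in> orbit_rel {p. p permutes X} ?\<Omega>" by (auto simp: orbit_rel_def)
    qed
  qed
  also have "?f ` ?\<Omega> = multisets_of_size Q (card X)"
  proof
    show "?f ` ?\<Omega> \<subseteq> multisets_of_size Q (card X)" using X by (auto simp: multisets_of_size_def)
    show "multisets_of_size Q (card X) \<subseteq> ?f ` ?\<Omega>"
    proof
      fix M assume M: "M \<in> multisets_of_size Q (card X)"
      obtain xs where xs: "mset xs = M" using ex_mset by blast
      with M have len: "length xs = card X" and sub: "set xs \<subseteq> Q"
        by (auto simp: multisets_of_size_def)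
      obtain h where h: "bij_betw h X {0..<card X}" using ex_bij_betw_finite_nat[OF X] by blast
      \<comment> \<open>A list of the elements of M is laid out along an enumeration h of X.\<close>
      define \<mu> where "\<mu> = (\<lambda>x\<in>X. xs ! h x)"
      have "?f \<mu> = image_mset (\<lambda>x. xs ! h x) (mset_set X)"
        by (intro image_mset_cong) (use X in \<open>auto simp: \<mu>_def\<close>)
      also have "\<dots> = image_mset ((!) xs) (image_mset h (mset_set X))"
        by (simp add: image_mset.compositionality comp_def)
      also have "image_mset h (mset_set X) = mset_set {0..<length xs}"
        using h by (simp add: image_mset_mset_set bij_betw_def len)
      also have "image_mset ((!) xs) (mset_set {0..<length xs}) = M"
        using xs by (metis map_nth mset_map mset_upt)
      finally have "M = ?f \<mu>" by simp
      moreover have "\<mu> \<in> ?\<Omega>"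
        using h sub len by (auto simp: \<mu>_def bij_betw_def intro!: subsetD[OF sub] nth_mem)
      ultimately show "M \<in> ?f ` ?\<Omega>" by blast
    qed
  qed
  finally show ?thesis by (simp add: card_multisets_of_size[OF Q])
qed

section \<open>Orbits of the alternating group\<close>

lemma prod_descending: "(\<Prod>i\<in>{0..<n}. m - i) = fact n * (m choose n)"
proof (induction n)
  case (Suc n)
  have "(m - n) * (m choose n) = Suc n * (m choose Suc n)"
    by (simp only: binomial_absorb_comp binomial_absorption)
  then show ?case by (simp add: Suc algebra_simps)
qed simp

text \<open>The falling factorial that counts injections also covers the case of X larger than Q: a
  factor is then 0, and so is the binomial coefficient. This occurs below for more than four
  positions.\<close>

lemma card_inj_PiE:
  assumes "finite X" "finite Q"
  shows "card {\<mu> \<in> X \<rightarrow>\<^sub>E Q. inj_on \<mu> X} = fact (card X) * (card Q choose card X)"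
  using card_inj_on_subset_funcset[OF assms subset_refl] by (simp add: prod_descending)

lemma perm_group_Alt:
  assumes "finite X"
  shows "perm_group X {p. p permutes X \<and> evenperm p}"
proof -
  have "permutation p" if "p permutes X" for p
    using that assms permutation_permutes by blast
  then show ?thesis
    by unfold_locales (auto simp: permutes_id permutes_compose permutes_inv evenperm_comp evenperm_inv)
qed

text \<open>If \<mu> takes the same value at two points, their transposition fixes \<mu>, and
  composing with it exchanges the even and the odd elements of the stabilizer. If \<mu> is
  injective, only the identity fixes it, and the identity is even.\<close>

lemma card_stabilizer_Alt:
  assumes X: "finite X"
  shows "2 * card {p. p permutes X \<and> evenperm p \<and> \<mu> \<circ> p = \<mu>}
    = card {p. p permutes X \<and> \<mu> \<circ> p = \<mu>} + (if inj_on \<mu> X then 1 else 0)"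
proof (cases "inj_on \<mu> X")
  case True
  have "p = id" if p: "p permutes X" "\<mu> \<circ> p = \<mu>" for p
  proof
    fix x
    show "p x = id x"
    proof (cases "x \<in> X")
      case x: True
      have "\<mu> (p x) = \<mu> x" using fun_cong[OF p(2), of x] by simp
      then show ?thesis using True x permutes_in_image[OF p(1)] by (simp add: inj_on_def)
    qed (simp add: permutes_not_in[OF p(1)])
  qed
  then have "{p. p permutes X \<and> evenperm p \<and> \<mu> \<circ> p = \<mu>} = {id}" "{p. p permutes X \<and> \<mu> \<circ> p = \<mu>} = {id}"
    by (auto simp: permutes_id)
  with True show ?thesis by simp
next
  case False
  then obtain x y where xy: "x \<in> X" "y \<in> X" "x \<noteq> y" "\<mu> x = \<mu> y" by (auto simp: inj_on_def)
  define \<tau> where "\<tau> = Transposition.transpose x y"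
  have \<tau>: "\<tau> permutes X" using xy by (simp add: \<tau>_def permutes_swap_id)
  have inv: "\<tau> \<circ> (\<tau> \<circ> p) = p" for p by (simp add: \<tau>_def comp_assoc[symmetric])
  have \<mu>\<tau>: "\<mu> \<circ> (\<tau> \<circ> p) = \<mu> \<circ> p" for p
    using xy by (auto simp: \<tau>_def fun_eq_iff Transposition.transpose_def)
  have par: "evenperm (\<tau> \<circ> p) \<longleftrightarrow> \<not> evenperm p" if "p permutes X" for p
    using that X xy \<tau> permutation_permutes[of p] permutation_permutes[of \<tau>]
    by (subst evenperm_comp) (auto simp: \<tau>_def evenperm_swap)
  let ?E = "{p. p permutes X \<and> evenperm p \<and> \<mu> \<circ> p = \<mu>}"
  let ?O = "{p. p permutes X \<and> \<not> evenperm p \<and> \<mu> \<circ> p = \<mu>}"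
  have "bij_betw ((\<circ>) \<tau>) ?E ?O"
    by (rule bij_betw_byWitness[where f' = "(\<circ>) \<tau>"])
      (use \<tau> in \<open>auto simp: inv par permutes_compose \<mu>\<tau>\<close>)
  then have "card ?E = card ?O" by (rule bij_betw_same_card)
  moreover have "card {p. p permutes X \<and> \<mu> \<circ> p = \<mu>} = card ?E + card ?O"
    by (subst card_Un_disjoint[symmetric])
      (auto intro: finite_subset[OF _ finite_permutations[OF X]] arg_cong[where f = card])
  ultimately show ?thesis using False by simp
qed

text \<open>Doubling the sum of the stabilizers in the alternating group gives the sum for the
  symmetric group plus one for each injective map. Division by the factorial turns the number of
  injective maps into \<open>card Q choose card X\<close>.\<close>

lemma card_orbits_Alt:
  assumes X: "finite X" and Q: "finite Q" and ge2: "card X \<ge> 2"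
  shows "card ((X \<rightarrow>\<^sub>E Q) // orbit_rel {p. p permutes X \<and> evenperm p} (X \<rightarrow>\<^sub>E Q))
    = ((card Q + card X - 1) choose card X) + (card Q choose card X)"
proof -
  let ?\<Omega> = "X \<rightarrow>\<^sub>E Q" and ?S = "{p. p permutes X}" and ?A = "{p. p permutes X \<and> evenperm p}"
  have fin: "finite ?\<Omega>" "finite ?S" "finite ?A"
    using X Q finite_permutations[OF X] by (auto intro!: finite_PiE)
  have closed: "\<mu> \<circ> p \<in> ?\<Omega>" if "\<mu> \<in> ?\<Omega>" "p permutes X" for \<mu> p
    using that by (rule PiE_comp_permutes)
  obtain x y where xy: "x \<in> X" "y \<in> X" "x \<noteq> y" using ge2 X
    by (metis One_nat_def Suc_1 card_le_Suc0_iff_eq not_less_eq_eq)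
  \<comment> \<open>A constant map is fixed by every permutation, and it is not injective because X
    has two points; its stabilizers are the full groups.\<close>
  have "2 * card ?A = card ?S"
    using card_stabilizer_Alt[OF X, of "\<lambda>_. ()"] xy by (auto simp: inj_on_def comp_def)
  then have "card (?\<Omega> // orbit_rel ?A ?\<Omega>) * card ?S = 2 * (card (?\<Omega> // orbit_rel ?A ?\<Omega>) * card ?A)" by simp
  also have "\<dots> = (\<Sum>\<mu>\<in>?\<Omega>. 2 * card {p \<in> ?A. \<mu> \<circ> p = \<mu>})"
    using perm_group.orbits_mult_card[OF perm_group_Alt[OF X] fin(3,1)] closed
    by (simp add: sum_distrib_left)
  also have "\<dots> = (\<Sum>\<mu>\<in>?\<Omega>. card {p \<in> ?S. \<mu> \<circ> p = \<mu>} + (if inj_on \<mu> X then 1 else 0))"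
    by (intro sum.cong refl) (simp add: conj_assoc card_stabilizer_Alt[OF X])
  also have "\<dots> = card (?\<Omega> // orbit_rel ?S ?\<Omega>) * card ?S + card {\<mu> \<in> ?\<Omega>. inj_on \<mu> X}"
    using perm_group.orbits_mult_card[OF perm_group_Sym fin(2,1)] closed fin(1)
    by (simp add: sum.distrib sum.If_cases Int_def)
  also have "\<dots> = (((card Q + card X - 1) choose card X) + (card Q choose card X)) * card ?S"
    by (simp add: card_orbits_Sym[OF X Q] card_inj_PiE[OF X Q] card_permutations[OF refl X] algebra_simps)
  finally show ?thesis using card_permutations[OF refl X] by simp
qed

section \<open>The cyclic and dihedral groups\<close>

lemma rotation_eq:
  assumes "k < N" "x \<in> {1..N}"
  shows "rotation N k x = (if x + k \<le> N then x + k else x + k - N)"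
proof (cases "x + k \<le> N")
  case True
  then have "(x - 1 + k) mod N = x - 1 + k" using assms by (intro mod_less) auto
  with True assms show ?thesis by (auto simp: rotation_def)
next
  case False
  \<comment> \<open>As k < N, the sum wraps around only once. The form without \<open>mod\<close> is
    accessible to linear arithmetic.\<close>
  then have "(x - 1 + k) mod N = x - 1 + k - N"
    using assms by (subst mod_if) auto
  with False assms show ?thesis by (auto simp: rotation_def)
qed

lemma rotation_outside: "x \<notin> {1..N} \<Longrightarrow> rotation N k x = x"
  by (auto simp: rotation_def)

lemma rotation_in:
  assumes "x \<in> {1..N}"
  shows "rotation N k x \<in> {1..N}"
proof -
  define m where "m = (x - 1 + k) mod N"
  have "rotation N k x = m + 1" using assms by (simp add: rotation_def m_def)
  moreover have "m < N" using assms by (simp add: m_def)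
  ultimately show ?thesis by simp
qed

lemma reversal_outside: "x \<notin> {1..N} \<Longrightarrow> reversal N x = x"
  by (auto simp: reversal_def)

lemma reversal_in: "x \<in> {1..N} \<Longrightarrow> reversal N x \<in> {1..N}"
  by (auto simp: reversal_def)

lemma rotation_comp:
  assumes "j < N" "k < N"
  shows "rotation N j \<circ> rotation N k = rotation N (if j + k < N then j + k else j + k - N)"
proof
  fix x show "(rotation N j \<circ> rotation N k) x = rotation N (if j + k < N then j + k else j + k - N) x"
  proof (cases "x \<in> {1..N}")
    case True
    then show ?thesis
      using assms rotation_in[OF True, of k] by (auto simp: rotation_eq)
  qed (simp add: rotation_outside)
qed

lemma rotation_0: "rotation N 0 = id"
  by (rule ext) (auto simp: rotation_def)

lemma reversal_reversal: "reversal N \<circ> reversal N = id"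
  by (rule ext) (auto simp: reversal_def)

text \<open>The dihedral relation: moving a reversal past a rotation inverts the rotation. The case
  k = 0 keeps the amount of the inverse rotation below N.\<close>

lemma reversal_rotation:
  assumes "k < N"
  shows "reversal N \<circ> rotation N k = rotation N (if k = 0 then 0 else N - k) \<circ> reversal N"
proof
  fix x show "(reversal N \<circ> rotation N k) x = (rotation N (if k = 0 then 0 else N - k) \<circ> reversal N) x"
  proof (cases "x \<in> {1..N}")
    case True
    then show ?thesis
      using assms rotation_in[OF True, of k] reversal_in[OF True]
      by (auto simp: rotation_eq reversal_def)
  qed (simp add: rotation_outside reversal_outside)
qed

lemma permutes_involutive_inverse:
  assumes "f \<circ> g = id" "g \<circ> f = id" "\<And>x. x \<notin> X \<Longrightarrow> f x = x"
  shows "f permutes X \<and> inv' f = g"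
proof
  have "bij f" using assms o_bij by blast
  then show "f permutes X"
    unfolding permutes_def using assms(3) by (simp add: bij_iff)
  show "inv' f = g" using assms by (metis inv_unique_comp)
qed

lemma rotation_inverse:
  assumes "k < N"
  shows "rotation N k permutes {1..N}" "inv' (rotation N k) = rotation N (if k = 0 then 0 else N - k)"
  using permutes_involutive_inverse[of "rotation N k" "rotation N (if k = 0 then 0 else N - k)" "{1..N}"] assms
  by (auto simp: rotation_comp rotation_0 rotation_outside)

lemma C_grp_eq: "C_grp N = rotation N ` {..<N}"
  by (auto simp: C_grp_def)

lemma perm_group_C:
  assumes "N \<ge> 1"
  shows "perm_group {1..N} (C_grp N)"
proof
  fix g h assume "g \<in> C_grp N"
  then obtain j where j: "j < N" "g = rotation N j" by (auto simp: C_grp_def)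
  then show "g permutes {1..N}" using rotation_inverse by simp
  show "inv' g \<in> C_grp N" using j rotation_inverse[OF j(1)] by (auto simp: C_grp_def)
  assume "h \<in> C_grp N"
  then obtain k where k: "k < N" "h = rotation N k" by (auto simp: C_grp_def)
  have "g \<circ> h = rotation N (if j + k < N then j + k else j + k - N)"
    using j k by (simp add: rotation_comp)
  moreover have "(if j + k < N then j + k else j + k - N) < N" using j k by auto
  ultimately show "g \<circ> h \<in> C_grp N" unfolding C_grp_def by blast
next
  show "id \<in> C_grp N" unfolding C_grp_eq by (rule image_eqI[of _ _ 0]) (use assms rotation_0 in auto)
qed

abbreviation reflection :: "nat \<Rightarrow> nat \<Rightarrow> nat \<Rightarrow> nat" where
  "reflection N k \<equiv> rotation N k \<circ> reversal N"

text \<open>Modulo N the reflection is x \<mapsto> k + 1 - x; the two cases choose the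
  representative in {1..N}.\<close>

lemma reflection_eq:
  assumes "k < N" "x \<in> {1..N}"
  shows "reflection N k x = (if k < x then N + k + 1 - x else k + 1 - x)"
proof -
  have "reflection N k x = rotation N k (N + 1 - x)" using assms by (simp add: reversal_def)
  then show ?thesis using assms by (subst (asm) rotation_eq) auto
qed

lemma reflection_involution:
  assumes "k < N"
  shows "reflection N k \<circ> reflection N k = id"
proof -
  have "reflection N k \<circ> reflection N k = rotation N k \<circ> (reversal N \<circ> rotation N k) \<circ> reversal N"
    by (simp add: comp_assoc)
  also have "\<dots> = (rotation N k \<circ> rotation N (if k = 0 then 0 else N - k)) \<circ> (reversal N \<circ> reversal N)"
    by (simp only: reversal_rotation[OF assms] comp_assoc)
  also have "\<dots> = id"
    using assms by (simp add: rotation_comp rotation_0 reversal_reversal)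
  finally show ?thesis .
qed

lemma reflection_inverse:
  assumes "k < N"
  shows "reflection N k permutes {1..N}" "inv' (reflection N k) = reflection N k"
  using permutes_involutive_inverse[of "reflection N k" "reflection N k" "{1..N}"]
    reflection_involution[OF assms]
  by (auto simp: rotation_outside reversal_outside)

lemma D_grp_eq: "D_grp N = C_grp N \<union> reflection N ` {..<N}"
  by (auto simp: D_grp_def)

text \<open>Each element is a rotation, or a rotation after the reversal. In a product,
  \<open>swap\<close> moves reversals to the right, where two of them cancel.\<close>

lemma perm_group_D:
  assumes N: "N \<ge> 1"
  shows "perm_group {1..N} (D_grp N)"
proof -
  interpret C: perm_group "{1..N}" "C_grp N" using perm_group_C[OF N] .
  have C: "g \<in> C_grp N \<longleftrightarrow> (\<exists>k<N. g = rotation N k)" for g by (auto simp: C_grp_def)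
  have D: "g \<in> D_grp N \<longleftrightarrow> g \<in> C_grp N \<or> (\<exists>h\<in>C_grp N. g = h \<circ> reversal N)" for g
    by (auto simp: D_grp_def C_grp_def)
  have swap: "\<exists>h'\<in>C_grp N. reversal N \<circ> h = h' \<circ> reversal N" if "h \<in> C_grp N" for h
  proof -
    from that obtain k where k: "k < N" "h = rotation N k" by (auto simp: C)
    have "(if k = 0 then 0 else N - k) < N" using k by auto
    then have "rotation N (if k = 0 then 0 else N - k) \<in> C_grp N" unfolding C by blast
    with k show ?thesis using reversal_rotation[OF k(1)] by blast
  qed
  show ?thesis
  proof
    fix g h assume g: "g \<in> D_grp N"
    show "g permutes {1..N}" "inv' g \<in> D_grp N"
      using g C.permutes C.inv_in reflection_inverse by (auto simp: D_grp_eq)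
    assume h: "h \<in> D_grp N"
    from g obtain g' where g': "g' \<in> C_grp N" "g = g' \<or> g = g' \<circ> reversal N" by (auto simp: D)
    from h obtain h' where h': "h' \<in> C_grp N" "h = h' \<or> h = h' \<circ> reversal N" by (auto simp: D)
    from swap[OF h'(1)] obtain h'' where h'': "h'' \<in> C_grp N" "reversal N \<circ> h' = h'' \<circ> reversal N" by blast
    have 1: "g' \<circ> h' \<in> C_grp N" "g' \<circ> h'' \<in> C_grp N" using g' h' h'' C.comp_in by auto
    have 2: "(g' \<circ> reversal N) \<circ> h' = (g' \<circ> h'') \<circ> reversal N"
      by (simp add: comp_assoc h''(2))
    have 3: "(g' \<circ> reversal N) \<circ> (h' \<circ> reversal N) = g' \<circ> h''"
    proof -
      have "(g' \<circ> reversal N) \<circ> (h' \<circ> reversal N) = g' \<circ> (reversal N \<circ> h') \<circ> reversal N"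
        by (simp only: comp_assoc)
      also have "\<dots> = g' \<circ> h'' \<circ> (reversal N \<circ> reversal N)" by (simp only: h''(2) comp_assoc)
      finally show ?thesis by (simp add: reversal_reversal)
    qed
    show "g \<circ> h \<in> D_grp N"
      using g'(2) h'(2) 1 2 3 by (metis D comp_assoc)
  next
    show "id \<in> D_grp N" using C.id_in by (simp add: D)
  qed
qed

lemma inj_rotation: "N \<ge> 1 \<Longrightarrow> inj_on (rotation N) {..<N}"
  by (rule inj_onI) (auto dest!: fun_cong[of _ _ 1] simp: rotation_def)

text \<open>The reversal takes N to 1, and the image of 1 determines a rotation.\<close>

lemma inj_reflection: "N \<ge> 1 \<Longrightarrow> inj_on (reflection N) {..<N}"
  by (rule inj_onI) (auto dest!: fun_cong[of _ _ N] simp: rotation_def reversal_def)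

text \<open>From 1 to 2 the value of a rotation rises by 1 modulo N and that of a reflection falls
  by 1. These agree only if N divides 2.\<close>

lemma C_reflection_disjoint:
  assumes "N \<ge> 3"
  shows "C_grp N \<inter> reflection N ` {..<N} = {}"
proof -
  have False if jk: "j < N" "k < N" and eq: "rotation N j = reflection N k" for j k
  proof -
    have "rotation N j x = reflection N k x" for x by (simp only: eq)
    from this[of 1] this[of 2] show False
      using assms jk reflection_eq[of k N 1] reflection_eq[of k N 2] rotation_eq[of j N 1] rotation_eq[of j N 2]
      by (auto split: if_splits)
  qed
  then show ?thesis by (auto simp: C_grp_eq)
qed

lemma D_grp_small:
  assumes "N = 1 \<or> N = 2"
  shows "D_grp N = C_grp N"
proof -
  have "\<exists>j<N. reflection N k = rotation N j" if k: "k < N" for k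
  proof (intro exI conjI)
    \<comment> \<open>For N = 2 the reversal is itself the rotation by 1, so the reflection is the
      rotation by k + 1 modulo 2. For N = 1 everything is the identity.\<close>
    let ?j = "if N = 2 then 1 - k else k"
    show j: "?j < N" using k assms by auto
    show "reflection N k = rotation N ?j"
    proof
      fix x show "reflection N k x = rotation N ?j x"
      proof (cases "x \<in> {1..N}")
        case True
        then show ?thesis
          unfolding reflection_eq[OF k True] rotation_eq[OF j True] using assms k by auto
      qed (simp add: rotation_outside reversal_outside)
    qed
  qed
  then show ?thesis by (auto simp: D_grp_eq C_grp_eq)
qed

section \<open>Numbers of maps fixed by rotations and reflections\<close>

lemma card_fixed_rotation:
  assumes N: "N \<ge> 1"
  shows "card {\<mu> \<in> {1..N} \<rightarrow>\<^sub>E Q. \<mu> \<circ> rotation N k = \<mu>} = card Q ^ gcd k N"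
proof -
  define g where "g = gcd k N"
  have g: "g \<ge> 1" "g dvd N" "g dvd k" "g \<le> N"
    using N by (auto simp: g_def Suc_le_eq One_nat_def intro: dvd_imp_le)
  \<comment> \<open>Invariance means the cyclic period k. Together with the period N this is the
    same as the period g, so the values at 1, ..., g can be chosen freely.\<close>
  have fixed: "\<mu> \<circ> rotation N k = \<mu> \<longleftrightarrow> (\<forall>x\<in>{1..N}. \<mu> x = \<mu> ((x - 1) mod g + 1))"
    if \<mu>: "\<mu> \<in> {1..N} \<rightarrow>\<^sub>E Q" for \<mu>
  proof -
    \<comment> \<open>The extension of \<mu> to a function of period N on all naturals, with
      positions counted from 0.\<close>
    define F where "F i = \<mu> (i mod N + 1)" for i
    have F_\<mu>: "\<mu> x = F (x - 1)" if "x \<in> {1..N}" for x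
      using that by (auto simp: F_def)
    have "\<mu> \<circ> rotation N k = \<mu> \<longleftrightarrow> (\<forall>x\<in>{1..N}. \<mu> (rotation N k x) = \<mu> x)"
      by (auto simp: fun_eq_iff) (metis atLeastAtMost_iff rotation_outside)
    also have "\<dots> \<longleftrightarrow> (\<forall>x\<in>{1..N}. F (x - 1 + k) = F (x - 1))"
      using F_\<mu> by (auto simp: rotation_def F_def)
    also have "\<dots> \<longleftrightarrow> (\<forall>i<N. F (i + k) = F i)"
    proof
      assume *: "\<forall>x\<in>{1..N}. F (x - 1 + k) = F (x - 1)"
      show "\<forall>i<N. F (i + k) = F i" using *[rule_format, of "_ + 1"] by auto
    next
      assume *: "\<forall>i<N. F (i + k) = F i"
      show "\<forall>x\<in>{1..N}. F (x - 1 + k) = F (x - 1)"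
      proof
        fix x assume "x \<in> {1..N}"
        then have "x - 1 < N" by auto
        then show "F (x - 1 + k) = F (x - 1)" using * by blast
      qed
    qed
    also have "\<dots> \<longleftrightarrow> (\<forall>i<N. F i = F (i mod g))"
    proof
      assume *: "\<forall>i<N. F (i + k) = F i"
      have k: "F (i + k) = F i" for i
      proof -
        have "F (i + k) = F (i mod N + k)" unfolding F_def by (simp add: mod_add_left_eq)
        also have "\<dots> = F (i mod N)" using * N by simp
        finally show ?thesis by (simp add: F_def)
      qed
      have km: "F (i + k * m) = F i" for i m
        by (induction m) (use k[of "i + k * _"] in \<open>simp_all add: algebra_simps\<close>)
      have Fg: "F (i + g) = F i" for i
      proof (cases "k = 0")
        \<comment> \<open>Here g = N, and F has period N by construction.\<close>
        case True
        then show ?thesis by (simp add: F_def g_def)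
      next
        case False
        \<comment> \<open>Bezout's identity over the naturals, for which k must be nonzero: a shift
          by g differs from a shift by a multiple of k only by a multiple of N.\<close>
        then obtain x y where xy: "k * x = N * y + g" unfolding g_def using bezout_nat by blast
        have "F (i + g) = F (i + g + N * y)" by (simp add: F_def)
        also have "\<dots> = F i" using km[of i x] by (simp add: xy add_ac)
        finally show ?thesis .
      qed
      have gm: "F (i + g * m) = F i" for i m
        by (induction m) (use Fg[of "i + g * _"] in \<open>simp_all add: algebra_simps\<close>)
      show "\<forall>i<N. F i = F (i mod g)"
        using gm[of "_ mod g" "_ div g"] by (metis mod_mult_div_eq)
    next
      assume *: "\<forall>i<N. F i = F (i mod g)"
      \<comment> \<open>Reducing modulo N first extends the hypothesis from i < N to all i; this is
        compatible with reduction modulo g because g divides N.\<close>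
      have F_mod: "F i = F (i mod g)" for i
      proof -
        have "F i = F (i mod N)" by (simp add: F_def)
        also have "\<dots> = F (i mod N mod g)" using * N by simp
        also have "i mod N mod g = i mod g" using g(2) by (rule mod_mod_cancel)
        finally show ?thesis .
      qed
      have "(i + k) mod g = i mod g" for i
        using g(3) by (auto elim!: dvdE)
      then show "\<forall>i<N. F (i + k) = F i" using F_mod by metis
    qed
    also have "\<dots> \<longleftrightarrow> (\<forall>x\<in>{1..N}. F (x - 1) = F ((x - 1) mod g))"
    proof
      assume *: "\<forall>x\<in>{1..N}. F (x - 1) = F ((x - 1) mod g)"
      show "\<forall>i<N. F i = F (i mod g)" using *[rule_format, of "_ + 1"] by auto
    qed auto
    also have "\<dots> \<longleftrightarrow> (\<forall>x\<in>{1..N}. \<mu> x = \<mu> ((x - 1) mod g + 1))"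
    proof (intro ball_cong refl)
      fix x assume x: "x \<in> {1..N}"
      have "(x - 1) mod g < g" using g(1) by (intro mod_less_divisor) simp
      then have "(x - 1) mod g < N" using g(4) by simp
      then have "F ((x - 1) mod g) = \<mu> ((x - 1) mod g + 1)" by (simp add: F_def)
      with F_\<mu>[OF x] show "F (x - 1) = F ((x - 1) mod g) \<longleftrightarrow> \<mu> x = \<mu> ((x - 1) mod g + 1)" by simp
    qed
    finally show ?thesis .
  qed
  then have "{\<mu> \<in> {1..N} \<rightarrow>\<^sub>E Q. \<mu> \<circ> rotation N k = \<mu>}
    = {\<mu> \<in> {1..N} \<rightarrow>\<^sub>E Q. \<forall>x\<in>{1..N}. \<mu> x = \<mu> ((x - 1) mod g + 1)}"
    by blast
  also have "card \<dots> = card Q ^ card {1..g}"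
  proof (rule card_PiE_retract)
    show "(x - 1) mod g + 1 \<in> {1..g}" for x
      using g by (auto simp: Suc_le_eq One_nat_def)
    show "(x - 1) mod g + 1 = x" if "x \<in> {1..g}" for x
    proof -
      have "(x - 1) mod g = x - 1" using that g by (intro mod_less) auto
      then show ?thesis using that by simp
    qed
  qed (use g in auto)
  finally show ?thesis by (simp add: g_def)
qed

text \<open>The numbers k with gcd d to N are counted by the totient of N div d; replacing d by the
  complementary divisor gives the form of the cycle index.\<close>

lemma sum_gcd_totient:
  fixes f :: "nat \<Rightarrow> nat"
  assumes N: "N \<ge> 1"
  shows "(\<Sum>k<N. f (gcd k N)) = (\<Sum>d | d dvd N. totient d * f (N div d))"
proof -
  have N0: "N > 0" using N by simp
  \<comment> \<open>The summand at 0 is moved to N, which has the same gcd with N, because the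
    totient count ranges over {0<..N}.\<close>
  have "(\<Sum>k<N. f (gcd k N)) = (\<Sum>k\<in>{0<..N}. f (gcd k N))"
    by (rule sum.reindex_bij_witness[where i = "\<lambda>k. if k = N then 0 else k" and j = "\<lambda>k. if k = 0 then N else k"])
      (use N in auto)
  also have "\<dots> = (\<Sum>d | d dvd N. \<Sum>k | k \<in> {0<..N} \<and> gcd k N = d. f (gcd k N))"
    using N by (intro sum.group[symmetric]) auto
  also have "\<dots> = (\<Sum>d | d dvd N. totient (N div d) * f d)"
    using N by (intro sum.cong refl) (simp add: card_gcd_eq_totient[symmetric])
  also have "\<dots> = (\<Sum>d | d dvd N. totient d * f (N div d))"
    by (rule sum.reindex_bij_witness[of _ "(div) N" "(div) N"]) (use N0 in \<open>auto elim: dvdE\<close>)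
  finally show ?thesis .
qed

lemma sum_fixed_C:
  assumes N: "N \<ge> 1"
  shows "real (\<Sum>g\<in>C_grp N. card {\<mu> \<in> all_indices N. \<mu> \<circ> g = \<mu>}) = real N * Z_C N (\<lambda>_. 4)"
proof -
  have "(\<Sum>g\<in>C_grp N. card {\<mu> \<in> all_indices N. \<mu> \<circ> g = \<mu>}) = (\<Sum>k<N. 4 ^ gcd k N)"
    unfolding C_grp_eq by (subst sum.reindex[OF inj_rotation[OF N]]) (simp add: card_fixed_rotation[OF N])
  also have "\<dots> = (\<Sum>d | d dvd N. totient d * 4 ^ (N div d))" by (rule sum_gcd_totient[OF N])
  finally show ?thesis using N by (simp add: Z_C_def)
qed

text \<open>A fixed point satisfies 2 * x = k + 1 or 2 * x = N + k + 1. For odd N exactly one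
  equation is solvable; for even N both are when k is odd, and neither when k is even. The exponent
  then follows from the count for involutions.\<close>

lemma card_fixed_reflection:
  assumes k: "k < N"
  shows "card {\<mu> \<in> all_indices N. \<mu> \<circ> reflection N k = \<mu>}
    = (if odd N then 4 ^ ((N + 1) div 2) else if odd k then 4 ^ (N div 2 + 1) else 4 ^ (N div 2))"
proof -
  have halves: "{x. 2 * x = n} = (if even n then {n div 2} else {})" for n :: nat
    by (auto elim!: evenE)
  have card_halves: "card {x. 2 * x = n} = (if even n then 1 else 0)" for n :: nat
    unfolding halves by simp
  have "reflection N k (reflection N k x) = x" for x
    using fun_cong[OF reflection_involution[OF k], of x] by simp
  then obtain t where t: "card {\<mu> \<in> all_indices N. \<mu> \<circ> reflection N k = \<mu>} = 4 ^ t"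
    "2 * t = N + card {x \<in> {1..N}. reflection N k x = x}"
    using card_fixed_involution[of "{1..N}" "reflection N k" "{0..3::nat}"] reflection_inverse[OF k] by auto
  have "{x \<in> {1..N}. reflection N k x = x} = {x. 2 * x = k + 1} \<union> {x. 2 * x = N + k + 1}"
    using k by (auto simp: reflection_eq simp del: comp_apply split: if_splits)
  then have "card {x \<in> {1..N}. reflection N k x = x} = card ({x. 2 * x = k + 1} \<union> {x. 2 * x = N + k + 1})"
    by simp
  also have "\<dots> = card {x. 2 * x = k + 1} + card {x. 2 * x = N + k + 1}"
    using k by (intro card_Un_disjoint) (auto simp: halves)
  also have "\<dots> = (if odd N then 1 else if odd k then 2 else 0)"
    unfolding card_halves by (cases "even N"; cases "even k") simp_all
  finally have "2 * t = N + (if odd N then 1 else if odd k then 2 else 0)" using t by simp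
  then have "t = (if odd N then (N + 1) div 2 else if odd k then N div 2 + 1 else N div 2)"
    by (auto split: if_splits)
  then show ?thesis using t(1) by simp
qed

lemma sum_alternating_parity: "(\<Sum>k<2 * m. if odd k then a else b) = m * (a + b :: nat)"
  by (induction m) (simp_all add: algebra_simps)

text \<open>The share of the reflections in 2 * N times \<open>Z_D\<close>, the rotations
  contributing N times \<open>Z_C\<close>. For odd N all reflections fix equally many maps; for even
  N the two kinds of axes alternate with the parity of k.\<close>

lemma sum_fixed_reflections:
  assumes N: "N \<ge> 1"
  shows "real (\<Sum>k<N. card {\<mu> \<in> all_indices N. \<mu> \<circ> reflection N k = \<mu>})
    = real N * (2 * Z_D N (\<lambda>_. 4) - Z_C N (\<lambda>_. 4))"
proof (cases "odd N")
  case True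
  then obtain m where m: "N = 2 * m + 1" by (auto elim: oddE)
  have sum: "(\<Sum>k<N. card {\<mu> \<in> all_indices N. \<mu> \<circ> reflection N k = \<mu>}) = N * 4 ^ (m + 1)"
    using True by (simp add: card_fixed_reflection m power_add)
  have "(N - 1) div 2 = m" using m by simp
  then have Z: "2 * Z_D N (\<lambda>_. 4) - Z_C N (\<lambda>_. 4) = 4 ^ (m + 1)"
    unfolding Z_D_def using True by (simp only: if_False power_add power_one_right) simp
  show ?thesis unfolding sum Z by (simp only: of_nat_mult of_nat_power of_nat_numeral)
next
  case False
  then obtain m where m: "N = 2 * m" by (auto elim: evenE)
  then obtain n where n: "m = Suc n" using N by (cases m) auto
  have "(\<Sum>k<N. card {\<mu> \<in> all_indices N. \<mu> \<circ> reflection N k = \<mu>})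
    = (\<Sum>k<2 * m. if odd k then 4 ^ (m + 1) else 4 ^ m)"
    using False by (intro sum.cong) (auto simp: card_fixed_reflection m)
  also have "\<dots> = m * (4 ^ (m + 1) + 4 ^ m)" by (rule sum_alternating_parity)
  finally have sum: "(\<Sum>k<N. card {\<mu> \<in> all_indices N. \<mu> \<circ> reflection N k = \<mu>}) = m * (5 * 4 ^ m)"
    by (simp add: power_add)
  have "N div 2 = m" "(N - 2) div 2 = n" using m n by simp_all
  then have Z: "2 * Z_D N (\<lambda>_. 4) - Z_C N (\<lambda>_. 4) = 5 * 4 ^ m / 2"
    using False by (simp add: Z_D_def n power2_eq_square)
  show ?thesis unfolding sum Z using m by simp
qed

text \<open>Both values are 4 for N = 1 and 10 for N = 2. This goes with \<open>D_grp_small\<close>,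
  where the group has N elements instead of 2 * N.\<close>

lemma Z_D_small:
  assumes "N = 1 \<or> N = 2"
  shows "Z_D N (\<lambda>_. 4) = Z_C N (\<lambda>_. 4)"
proof -
  have "{d. d dvd (2::nat)} = {1, 2}" using two_is_prime_nat by (auto simp: prime_nat_iff)
  with assms show ?thesis by (auto simp: Z_D_def Z_C_def)
qed

section \<open>The Pauli basis\<close>

text \<open>The functionals \<kappa> jointly identify V with the families of scalars indexed by I.
  Surjectivity provides a family e dual to \<kappa>; applying \<kappa> to a combination reads off
  its coefficients, so e is independent, and by injectivity it spans.\<close>

lemma dim_eq_card_coordinates:
  fixes V :: "('a::field, 'v) module" and \<kappa> :: "'i \<Rightarrow> 'v \<Rightarrow> 'a"
  assumes V: "vectorspace class_ring V" and I: "finite I"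
    and add: "\<And>i x y. i \<in> I \<Longrightarrow> x \<in> carrier V \<Longrightarrow> y \<in> carrier V \<Longrightarrow> \<kappa> i (x \<oplus>\<^bsub>V\<^esub> y) = \<kappa> i x + \<kappa> i y"
    and smult: "\<And>i r x. i \<in> I \<Longrightarrow> x \<in> carrier V \<Longrightarrow> \<kappa> i (r \<odot>\<^bsub>V\<^esub> x) = r * \<kappa> i x"
    and inj: "\<And>x y. x \<in> carrier V \<Longrightarrow> y \<in> carrier V \<Longrightarrow> (\<And>i. i \<in> I \<Longrightarrow> \<kappa> i x = \<kappa> i y) \<Longrightarrow> x = y"
    and surj: "\<And>c. \<exists>x\<in>carrier V. \<forall>i\<in>I. \<kappa> i x = c i"
  shows "vectorspace.dim class_ring V = card I"
proof -
  interpret vectorspace class_ring V by fact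
  have "\<forall>j. \<exists>x\<in>carrier V. \<forall>i\<in>I. \<kappa> i x = (if i = j then 1 else 0)"
    by (intro allI surj)
  then obtain e where e: "\<And>j. e j \<in> carrier V"
    and \<kappa>e: "\<And>i j. i \<in> I \<Longrightarrow> \<kappa> i (e j) = (if i = j then 1 else 0)"
    by metis
  have inj_e: "inj_on e I"
    by (rule inj_onI) (metis \<kappa>e zero_neq_one)
  have zero: "\<kappa> i \<zero>\<^bsub>V\<^esub> = 0" if "i \<in> I" for i
    using smult[OF that, of "\<zero>\<^bsub>V\<^esub>" 0] by simp
  have lincomb: "\<kappa> i (lincomb a S) = (\<Sum>v\<in>S. a v * \<kappa> i v)"
    if i: "i \<in> I" and "finite S" "S \<subseteq> carrier V" for i S a
    using that(2,3)
  proof (induction S)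
    case empty
    then show ?case by (simp add: lincomb_def zero[OF i])
  next
    case (insert v S)
    have "lincomb a (insert v S) = a v \<odot>\<^bsub>V\<^esub> v \<oplus>\<^bsub>V\<^esub> lincomb a S"
      using insert by (intro lincomb_insert2) auto
    with insert show ?case by (simp add: add[OF i] smult[OF i])
  qed
  have lincomb_e: "\<kappa> i (lincomb a (e ` I)) = a (e i)" if "i \<in> I" for i a
  proof -
    have "\<kappa> i (lincomb a (e ` I)) = (\<Sum>j\<in>I. a (e j) * \<kappa> i (e j))"
      using e I that by (subst lincomb) (auto simp: sum.reindex[OF inj_e])
    also have "\<dots> = a (e i)"
      using I that by (simp add: \<kappa>e if_distrib cong: if_cong)
    finally show ?thesis .
  qed
  have sub: "e ` I \<subseteq> carrier V" using e by auto
  have fin: "finite (e ` I)" using I by simp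
  have "lin_indpt (e ` I)"
  proof (rule finite_lin_indpt2[OF fin sub])
    fix a assume "lincomb a (e ` I) = \<zero>\<^bsub>V\<^esub>"
    then show "\<forall>v\<in>e ` I. a v = \<zero>\<^bsub>class_ring\<^esub>"
      using lincomb_e[of _ a] zero by auto
  qed
  moreover have "gen_set (e ` I)"
  proof
    show "span (e ` I) \<subseteq> carrier V" using sub by (rule span_is_subset2)
    show "carrier V \<subseteq> span (e ` I)"
    proof
      fix x assume x: "x \<in> carrier V"
      \<comment> \<open>\<open>lincomb\<close> expects coefficients indexed by vectors, so the index
        of a basis vector is recovered through the inverse of e.\<close>
      define a where "a v = \<kappa> (the_inv_into I e v) x" for v
      have "x = lincomb a (e ` I)"
        using x sub by (intro inj) (auto simp: lincomb_e a_def the_inv_into_f_f[OF inj_e])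
      then show "x \<in> span (e ` I)" unfolding finite_span[OF fin sub] by auto
    qed
  qed
  ultimately have "basis (e ` I)" unfolding basis_def using sub by simp
  then have "dim = card (e ` I)" using fin by (rule dim_basis[rotated])
  then show ?thesis by (simp add: card_image[OF inj_e])
qed

section \<open>The real vector space su(n)\<close>

lemma mat_adjoint_carrier: "A \<in> carrier_mat n m \<Longrightarrow> mat_adjoint A \<in> carrier_mat m n"
  by (auto simp: mat_adjoint_def)

lemma mat_adjoint_index:
  assumes "A \<in> carrier_mat n m" "i < m" "j < n"
  shows "mat_adjoint A $$ (i, j) = conjugate (A $$ (j, i))"
  using assms by (auto simp: mat_adjoint_def mat_of_rows_index)

lemma su_simps:
  "zero (su n) = 0\<^sub>m n n" "add (su n) = (+)" "smult (su n) = (\<lambda>r A. complex_of_real r \<cdot>\<^sub>m A)"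
  by (simp_all add: su_def)

lemma su_carrier_iff:
  "A \<in> carrier (su n) \<longleftrightarrow> A \<in> carrier_mat n n \<and> (\<Sum>i<n. A $$ (i, i)) = 0 \<and>
     (\<forall>i<n. \<forall>j<n. cnj (A $$ (j, i)) = - A $$ (i, j))"
proof -
  have "mat_adjoint A = - A \<longleftrightarrow> (\<forall>i<n. \<forall>j<n. cnj (A $$ (j, i)) = - A $$ (i, j))"
    if A: "A \<in> carrier_mat n n"
  proof
    assume "mat_adjoint A = - A"
    then show "\<forall>i<n. \<forall>j<n. cnj (A $$ (j, i)) = - A $$ (i, j)"
      using mat_adjoint_index[OF A] A by (auto simp: conjugate_complex_def)
  next
    assume "\<forall>i<n. \<forall>j<n. cnj (A $$ (j, i)) = - A $$ (i, j)"
    then show "mat_adjoint A = - A"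
      using mat_adjoint_index[OF A] mat_adjoint_carrier[OF A] A
      by (intro eq_matI) (auto simp: conjugate_complex_def)
  qed
  then show ?thesis by (auto simp: su_def)
qed

lemma su_carrier: "A \<in> carrier (su n) \<Longrightarrow> A \<in> carrier_mat n n"
  by (simp add: su_carrier_iff)

text \<open>Formulated for subsets because \<open>Gsu\<close> replaces only the carrier of
  \<open>su\<close>. Negatives come from scaling by -1.\<close>

lemma vectorspace_su_subset:
  assumes "C \<subseteq> carrier (su n)" "0\<^sub>m n n \<in> C"
    and "\<And>A B. A \<in> C \<Longrightarrow> B \<in> C \<Longrightarrow> A + B \<in> C"
    and "\<And>r A. A \<in> C \<Longrightarrow> complex_of_real r \<cdot>\<^sub>m A \<in> C"
  shows "vectorspace class_ring ((su n)\<lparr>carrier := C\<rparr>)"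
proof -
  have *: "A \<in> carrier_mat n n" if "A \<in> C" for A
    using assms(1) that su_carrier_iff by blast
  have neg: "\<exists>B\<in>C. A + B = 0\<^sub>m n n" if "A \<in> C" for A
    using assms(4)[OF that, of "-1"] *[OF that]
    by (intro bexI[of _ "complex_of_real (-1) \<cdot>\<^sub>m A"]) auto
  have assoc: "complex_of_real (r * s) \<cdot>\<^sub>m A = complex_of_real r \<cdot>\<^sub>m (complex_of_real s \<cdot>\<^sub>m A)"
    for r s A by (rule eq_matI) auto
  show ?thesis
    by (rule vs_criteria)
      (use assms neg * in \<open>auto simp: su_simps assoc class_field add_smult_distrib_left_mat[OF * *] add_smult_distrib_right_mat[OF *] intro: comm_add_mat[OF * *] assoc_add_mat[OF * * *]\<close>)
qed

section \<open>Kronecker products of Pauli matrices\<close>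

definition pauli_product :: "nat list \<Rightarrow> (nat \<Rightarrow> nat) \<Rightarrow> complex mat" where
  "pauli_product ks \<mu> = foldr kronecker (map (\<lambda>k. pauli (\<mu> k)) ks) (1\<^sub>m 1)"

text \<open>Products over an arbitrary list of positions, of which Pauli strings are a special case,
  admit induction on the list.\<close>

lemma pauli_string_eq: "pauli_string N \<mu> = pauli_product [1..<Suc N] \<mu>"
  by (simp add: pauli_string_def pauli_product_def)

lemma pauli_carrier: "pauli m \<in> carrier_mat 2 2"
  by (auto simp: pauli_def mat_of_rows_list_def)

lemma pauli_index:
  assumes "i < 2" "j < 2"
  shows "pauli m $$ (i, j) =
    (if m = 0 then (if i = j then 1 else 0)
     else if m = 1 then (if i = j then 0 else 1)
     else if m = 2 then (if i = j then 0 else if i = 0 then - \<i> else \<i>)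
     else (if i \<noteq> j then 0 else if i = 0 then 1 else - 1))"
proof -
  have "i = 0 \<or> i = 1" "j = 0 \<or> j = 1" using assms by auto
  then show ?thesis by (auto simp: pauli_def mat_of_rows_list_def)
qed

lemma pauli_hermitian: "i < 2 \<Longrightarrow> j < 2 \<Longrightarrow> cnj (pauli m $$ (j, i)) = pauli m $$ (i, j)"
  by (auto simp: pauli_index)

text \<open>The Fierz completeness relation, which is the expansion of a 2 by 2 matrix A as half the
  sum of \<open>tr (\<sigma>\<^sub>m A) \<sigma>\<^sub>m\<close>, read entry by entry.\<close>

lemma pauli_complete:
  assumes "i < 2" "j < 2" "k < 2" "l < 2"
  shows "(\<Sum>m\<in>{0..3}. pauli m $$ (i, j) * pauli m $$ (k, l)) = (if i = l \<and> j = k then 2 else 0)"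
proof -
  have "i = 0 \<or> i = 1" "j = 0 \<or> j = 1" "k = 0 \<or> k = 1" "l = 0 \<or> l = 1"
    using assms by auto
  moreover have set: "{0..3} = {0, 1, 2, 3::nat}" by auto
  ultimately show ?thesis
    by (elim disjE) (simp_all add: pauli_index set)
qed

lemma pauli_orthogonal:
  assumes "m \<le> 3" "m' \<le> 3"
  shows "(\<Sum>i<2. \<Sum>j<2. pauli m $$ (i, j) * pauli m' $$ (j, i)) = (if m = m' then 2 else 0)"
proof -
  have "m = 0 \<or> m = 1 \<or> m = 2 \<or> m = 3" "m' = 0 \<or> m' = 1 \<or> m' = 2 \<or> m' = 3"
    using assms by auto
  then show ?thesis
    by (elim disjE) (simp_all add: pauli_index numeral_2_eq_2 lessThan_Suc)
qed

lemma kronecker_carrier: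
  "A \<in> carrier_mat n n \<Longrightarrow> B \<in> carrier_mat m m \<Longrightarrow> kronecker A B \<in> carrier_mat (n * m) (n * m)"
  by (auto simp: kronecker_def)

lemma pauli_product_carrier: "pauli_product ks \<mu> \<in> carrier_mat (2 ^ length ks) (2 ^ length ks)"
proof (induction ks)
  case (Cons k ks)
  then show ?case
    using kronecker_carrier[OF pauli_carrier Cons.IH] by (simp add: pauli_product_def)
qed (simp add: pauli_product_def)

text \<open>The leading binary digit of a matrix index is read by the first Kronecker factor, the
  remaining digits by the others. The inductions over the positions all rest on this
  splitting.\<close>

lemma pauli_product_Cons_index:
  assumes "a < 2" "b < 2" "i < 2 ^ length ks" "j < 2 ^ length ks"
  shows "pauli_product (k # ks) \<mu> $$ (a * 2 ^ length ks + i, b * 2 ^ length ks + j)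
    = pauli (\<mu> k) $$ (a, b) * pauli_product ks \<mu> $$ (i, j)"
proof -
  have eq: "pauli_product (k # ks) \<mu> = kronecker (pauli (\<mu> k)) (pauli_product ks \<mu>)"
    by (simp add: pauli_product_def)
  have *: "c * 2 ^ length ks + x < 2 * 2 ^ length ks" if "c < 2" "x < 2 ^ length ks" for c x :: nat
  proof -
    have "c = 0 \<or> c = 1" using that by auto
    then show ?thesis using that by auto
  qed
  have dims: "dim_row (pauli (\<mu> k)) = 2" "dim_col (pauli (\<mu> k)) = 2"
    "dim_row (pauli_product ks \<mu>) = 2 ^ length ks" "dim_col (pauli_product ks \<mu>) = 2 ^ length ks"
    using pauli_carrier[of "\<mu> k"] pauli_product_carrier[of ks \<mu>] by auto
  show ?thesis using assms *[OF assms(1,3)] *[OF assms(2,4)]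
    by (simp add: eq kronecker_def dims)
qed

lemma block_index:
  assumes "x < 2 * 2 ^ n"
  obtains a i where "x = a * 2 ^ n + i" "a < 2" "i < (2 ^ n :: nat)"
proof
  show "x = x div 2 ^ n * 2 ^ n + x mod 2 ^ n" by (rule div_mult_mod_eq[symmetric])
  show "x div 2 ^ n < 2" using assms by (simp add: less_mult_imp_div_less)
  show "x mod 2 ^ n < 2 ^ n" by simp
qed

lemma block_index_eq_iff:
  assumes "i < 2 ^ n" "j < (2 ^ n :: nat)"
  shows "a * 2 ^ n + i = b * 2 ^ n + j \<longleftrightarrow> a = b \<and> i = j"
proof
  assume eq: "a * 2 ^ n + i = b * 2 ^ n + j"
  from arg_cong[OF this, of "\<lambda>x. x div 2 ^ n"] arg_cong[OF this, of "\<lambda>x. x mod 2 ^ n"]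
  show "a = b \<and> i = j" using assms by simp
qed simp

lemma sum_block:
  fixes f :: "nat \<Rightarrow> 'a::comm_monoid_add"
  shows "(\<Sum>x<2 ^ Suc n. f x) = (\<Sum>a<2. \<Sum>i<2 ^ n. f (a * 2 ^ n + i))"
  using sum.nat_group[of f "2 ^ n" 2] by (simp add: sum.nat_group[symmetric] sum.atLeastLessThan_shift_0 atLeast0LessThan)

lemma pauli_product_hermitian:
  assumes "i < 2 ^ length ks" "j < 2 ^ length ks"
  shows "cnj (pauli_product ks \<mu> $$ (j, i)) = pauli_product ks \<mu> $$ (i, j)"
  using assms
proof (induction ks arbitrary: i j)
  case Nil
  then show ?case by (simp add: pauli_product_def)
next
  case (Cons k ks)
  from Cons.prems obtain a i' where i: "i = a * 2 ^ length ks + i'" "a < 2" "i' < 2 ^ length ks"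
    by (auto elim: block_index)
  from Cons.prems obtain b j' where j: "j = b * 2 ^ length ks + j'" "b < 2" "j' < 2 ^ length ks"
    by (auto elim: block_index)
  show ?case
    using i j by (simp add: pauli_product_Cons_index pauli_hermitian Cons.IH)
qed

lemma pauli_product_cong: "(\<And>k. k \<in> set ks \<Longrightarrow> \<mu> k = \<nu> k) \<Longrightarrow> pauli_product ks \<mu> = pauli_product ks \<nu>"
  unfolding pauli_product_def by (metis (mono_tags, lifting) map_eq_conv)

text \<open>Both sides factor over the positions, and at each single position the claim is
  \<open>pauli_complete\<close>.\<close>

lemma pauli_product_complete:
  assumes "distinct ks" "i < 2 ^ length ks" "j < 2 ^ length ks" "k < 2 ^ length ks" "l < 2 ^ length ks"
  shows "(\<Sum>\<mu>\<in>set ks \<rightarrow>\<^sub>E {0..3}. pauli_product ks \<mu> $$ (i, j) * pauli_product ks \<mu> $$ (k, l))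
    = (if i = l \<and> j = k then 2 ^ length ks else 0)"
  using assms
proof (induction ks arbitrary: i j k l)
  case Nil
  then show ?case by (simp add: pauli_product_def)
next
  case (Cons q ks)
  let ?n = "length ks" and ?\<Omega> = "set ks \<rightarrow>\<^sub>E {0..3::nat}"
  from Cons.prems obtain a i' where i: "i = a * 2 ^ ?n + i'" "a < 2" "i' < 2 ^ ?n"
    by (auto elim: block_index)
  from Cons.prems obtain b j' where j: "j = b * 2 ^ ?n + j'" "b < 2" "j' < 2 ^ ?n"
    by (auto elim: block_index)
  from Cons.prems obtain c k' where k: "k = c * 2 ^ ?n + k'" "c < 2" "k' < 2 ^ ?n"
    by (auto elim: block_index)
  from Cons.prems obtain d l' where l: "l = d * 2 ^ ?n + l'" "d < 2" "l' < 2 ^ ?n"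
    by (auto elim: block_index)
  have q: "q \<notin> set ks" using Cons.prems by simp
  \<comment> \<open>An index on q # ks is a value m at q together with an index on ks. By
    distinctness the value at q does not affect the product over ks, so the sum becomes a product of
    two sums.\<close>
  have upd: "pauli_product ks (\<mu>(q := m)) = pauli_product ks \<mu>" for \<mu> m
    using q by (intro pauli_product_cong) auto
  have "(\<Sum>\<mu>\<in>set (q # ks) \<rightarrow>\<^sub>E {0..3}. pauli_product (q # ks) \<mu> $$ (i, j) * pauli_product (q # ks) \<mu> $$ (k, l))
    = (\<Sum>(m, \<mu>)\<in>{0..3} \<times> ?\<Omega>. (pauli m $$ (a, b) * pauli m $$ (c, d)) *
        (pauli_product ks \<mu> $$ (i', j') * pauli_product ks \<mu> $$ (k', l')))"
    unfolding list.set(2) PiE_insert_eq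
    by (subst sum.reindex[OF inj_combinator[OF q]], rule sum.cong)
      (use i j k l in \<open>auto simp: pauli_product_Cons_index upd\<close>)
  also have "\<dots> = (\<Sum>m\<in>{0..3}. pauli m $$ (a, b) * pauli m $$ (c, d)) *
        (\<Sum>\<mu>\<in>?\<Omega>. pauli_product ks \<mu> $$ (i', j') * pauli_product ks \<mu> $$ (k', l'))"
    by (simp only: sum_product sum.cartesian_product)
  also have "\<dots> = (if i = l \<and> j = k then 2 ^ length (q # ks) else 0)"
    using Cons.prems Cons.IH[of i' j' k' l'] i j k l by (simp add: pauli_complete block_index_eq_iff)
  finally show ?case .
qed

text \<open>The trace is multiplicative under Kronecker products, so each position contributes its
  own factor. Membership in \<open>\<rightarrow>\<close> instead of
  \<open>\<rightarrow>\<^sub>E\<close> is inherited by the tail without restricting the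
  maps.\<close>

lemma pauli_product_orthogonal:
  assumes "distinct ks" "\<mu> \<in> set ks \<rightarrow> {0..3}" "\<nu> \<in> set ks \<rightarrow> {0..3}"
  shows "(\<Sum>i<2 ^ length ks. \<Sum>j<2 ^ length ks. pauli_product ks \<mu> $$ (i, j) * pauli_product ks \<nu> $$ (j, i))
    = (if \<forall>k\<in>set ks. \<mu> k = \<nu> k then 2 ^ length ks else 0)"
  using assms
proof (induction ks)
  case Nil
  then show ?case by (simp add: pauli_product_def)
next
  case (Cons q ks)
  let ?n = "length ks"
  have "(\<Sum>i<2 ^ length (q # ks). \<Sum>j<2 ^ length (q # ks).
      pauli_product (q # ks) \<mu> $$ (i, j) * pauli_product (q # ks) \<nu> $$ (j, i))
    = (\<Sum>a<2. \<Sum>i<2 ^ ?n. \<Sum>b<2. \<Sum>j<2 ^ ?n. (pauli (\<mu> q) $$ (a, b) * pauli (\<nu> q) $$ (b, a)) *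
        (pauli_product ks \<mu> $$ (i, j) * pauli_product ks \<nu> $$ (j, i)))"
    unfolding list.size(4) add_Suc_right add_0_right sum_block
    by (intro sum.cong refl) (simp add: pauli_product_Cons_index)
  also have "\<dots> = (\<Sum>a<2. \<Sum>b<2. \<Sum>i<2 ^ ?n. \<Sum>j<2 ^ ?n. (pauli (\<mu> q) $$ (a, b) * pauli (\<nu> q) $$ (b, a)) *
        (pauli_product ks \<mu> $$ (i, j) * pauli_product ks \<nu> $$ (j, i)))"
    by (intro sum.cong refl sum.swap)
  also have "\<dots> = (\<Sum>a<2. \<Sum>b<2. pauli (\<mu> q) $$ (a, b) * pauli (\<nu> q) $$ (b, a)) *
        (\<Sum>i<2 ^ ?n. \<Sum>j<2 ^ ?n. pauli_product ks \<mu> $$ (i, j) * pauli_product ks \<nu> $$ (j, i))"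
    by (simp only: sum_distrib_right) (simp only: sum_distrib_left)
  also have "\<dots> = (if \<forall>k\<in>set (q # ks). \<mu> k = \<nu> k then 2 ^ length (q # ks) else 0)"
    using Cons by (subst pauli_orthogonal) auto
  finally show ?case .
qed

lemma pauli_product_zero:
  assumes "\<And>k. k \<in> set ks \<Longrightarrow> \<mu> k = 0" "i < 2 ^ length ks" "j < 2 ^ length ks"
  shows "pauli_product ks \<mu> $$ (i, j) = (if i = j then 1 else 0)"
  using assms
proof (induction ks arbitrary: i j)
  case Nil
  then show ?case by (simp add: pauli_product_def)
next
  case (Cons k ks)
  from Cons.prems obtain a i' where i: "i = a * 2 ^ length ks + i'" "a < 2" "i' < 2 ^ length ks"
    by (auto elim: block_index)
  from Cons.prems obtain b j' where j: "j = b * 2 ^ length ks + j'" "b < 2" "j' < 2 ^ length ks"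
    by (auto elim: block_index)
  show ?case
    using i j Cons by (simp add: pauli_product_Cons_index pauli_index block_index_eq_iff)
qed

section \<open>Pauli strings on N positions\<close>

lemma set_positions: "set [1..<Suc N] = {1..N}"
  by (simp add: atLeastLessThanSuc_atLeastAtMost del: upt_Suc)

lemma pauli_string_carrier: "pauli_string N \<mu> \<in> carrier_mat (2 ^ N) (2 ^ N)"
  using pauli_product_carrier[of "[1..<Suc N]" \<mu>] by (simp add: pauli_string_eq del: upt_Suc)

lemma pauli_string_hermitian:
  "i < 2 ^ N \<Longrightarrow> j < 2 ^ N \<Longrightarrow> cnj (pauli_string N \<mu> $$ (j, i)) = pauli_string N \<mu> $$ (i, j)"
  using pauli_product_hermitian[of i "[1..<Suc N]" j \<mu>] by (simp add: pauli_string_eq del: upt_Suc)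

lemma pauli_string_complete:
  assumes "i < 2 ^ N" "j < 2 ^ N" "k < 2 ^ N" "l < 2 ^ N"
  shows "(\<Sum>\<mu>\<in>all_indices N. pauli_string N \<mu> $$ (i, j) * pauli_string N \<mu> $$ (k, l))
    = (if i = l \<and> j = k then 2 ^ N else 0)"
  using pauli_product_complete[of "[1..<Suc N]" i j k l] assms
  by (simp add: pauli_string_eq set_positions del: upt_Suc set_upt)

lemma pauli_string_orthogonal:
  assumes "\<mu> \<in> all_indices N" "\<nu> \<in> all_indices N"
  shows "(\<Sum>i<2 ^ N. \<Sum>j<2 ^ N. pauli_string N \<mu> $$ (i, j) * pauli_string N \<nu> $$ (j, i))
    = (if \<mu> = \<nu> then 2 ^ N else 0)"
proof -
  have "(\<forall>k\<in>{1..N}. \<mu> k = \<nu> k) \<longleftrightarrow> \<mu> = \<nu>" using assms by (metis PiE_ext)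
  moreover have "\<mu> \<in> {1..N} \<rightarrow> {0..3}" "\<nu> \<in> {1..N} \<rightarrow> {0..3}" using assms by auto
  ultimately show ?thesis
    using pauli_product_orthogonal[of "[1..<Suc N]" \<mu> \<nu>]
    by (simp add: pauli_string_eq set_positions del: upt_Suc set_upt)
qed

lemma pauli_string_zero_index:
  "i < 2 ^ N \<Longrightarrow> j < 2 ^ N \<Longrightarrow> pauli_string N (zero_index N) $$ (i, j) = (if i = j then 1 else 0)"
  using pauli_product_zero[of "[1..<Suc N]" "zero_index N" i j]
  by (simp add: pauli_string_eq set_positions del: upt_Suc set_upt)

section \<open>Coefficients with respect to the Pauli basis\<close>

definition pauli_coeff :: "nat \<Rightarrow> (nat \<Rightarrow> nat) \<Rightarrow> complex mat \<Rightarrow> real" where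
  "pauli_coeff N \<mu> A = Im (\<Sum>i<2 ^ N. \<Sum>j<2 ^ N. pauli_string N \<mu> $$ (i, j) * A $$ (j, i)) / 2 ^ N"

text \<open>The matrix with prescribed real coefficients. It is given entry by entry because
  matrices of all sizes share one type, which has no common zero from which to sum.\<close>

definition pauli_comb :: "nat \<Rightarrow> ((nat \<Rightarrow> nat) \<Rightarrow> real) \<Rightarrow> complex mat" where
  "pauli_comb N c = mat (2 ^ N) (2 ^ N)
     (\<lambda>(k, l). \<Sum>\<nu>\<in>pauli_indices N. \<i> * complex_of_real (c \<nu>) * pauli_string N \<nu> $$ (k, l))"

lemma pauli_coeff_add:
  assumes "A \<in> carrier_mat (2 ^ N) (2 ^ N)" "B \<in> carrier_mat (2 ^ N) (2 ^ N)"
  shows "pauli_coeff N \<mu> (A + B) = pauli_coeff N \<mu> A + pauli_coeff N \<mu> B"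
proof -
  have "(\<Sum>i<2 ^ N. \<Sum>j<2 ^ N. pauli_string N \<mu> $$ (i, j) * (A + B) $$ (j, i))
    = (\<Sum>i<2 ^ N. \<Sum>j<2 ^ N. pauli_string N \<mu> $$ (i, j) * A $$ (j, i) + pauli_string N \<mu> $$ (i, j) * B $$ (j, i))"
    using assms by (intro sum.cong refl) (auto simp: distrib_left)
  then show ?thesis
    unfolding pauli_coeff_def by (simp add: sum.distrib add_divide_distrib)
qed

lemma pauli_coeff_smult:
  assumes "A \<in> carrier_mat (2 ^ N) (2 ^ N)"
  shows "pauli_coeff N \<mu> (complex_of_real r \<cdot>\<^sub>m A) = r * pauli_coeff N \<mu> A"
proof -
  have "(\<Sum>i<2 ^ N. \<Sum>j<2 ^ N. pauli_string N \<mu> $$ (i, j) * (complex_of_real r \<cdot>\<^sub>m A) $$ (j, i))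
    = complex_of_real r * (\<Sum>i<2 ^ N. \<Sum>j<2 ^ N. pauli_string N \<mu> $$ (i, j) * A $$ (j, i))"
    unfolding sum_distrib_left using assms by (intro sum.cong refl) auto
  then show ?thesis
    unfolding pauli_coeff_def by simp
qed

lemma pauli_comb_pairing:
  assumes "\<mu> \<in> all_indices N"
  shows "(\<Sum>i<2 ^ N. \<Sum>j<2 ^ N. pauli_string N \<mu> $$ (i, j) * pauli_comb N c $$ (j, i))
    = (if \<mu> \<in> pauli_indices N then 2 ^ N * (\<i> * complex_of_real (c \<mu>)) else 0)"
proof -
  have "(\<Sum>i<2 ^ N. \<Sum>j<2 ^ N. pauli_string N \<mu> $$ (i, j) * pauli_comb N c $$ (j, i))
    = (\<Sum>i<2 ^ N. \<Sum>j<2 ^ N. \<Sum>\<nu>\<in>pauli_indices N. \<i> * complex_of_real (c \<nu>) *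
        (pauli_string N \<mu> $$ (i, j) * pauli_string N \<nu> $$ (j, i)))"
    by (intro sum.cong refl) (simp add: pauli_comb_def sum_distrib_left mult_ac)
  also have "\<dots> = (\<Sum>i<2 ^ N. \<Sum>\<nu>\<in>pauli_indices N. \<Sum>j<2 ^ N. \<i> * complex_of_real (c \<nu>) *
        (pauli_string N \<mu> $$ (i, j) * pauli_string N \<nu> $$ (j, i)))"
    by (intro sum.cong refl sum.swap)
  also have "\<dots> = (\<Sum>\<nu>\<in>pauli_indices N. \<Sum>i<2 ^ N. \<Sum>j<2 ^ N. \<i> * complex_of_real (c \<nu>) *
        (pauli_string N \<mu> $$ (i, j) * pauli_string N \<nu> $$ (j, i)))"
    by (rule sum.swap)
  also have "\<dots> = (\<Sum>\<nu>\<in>pauli_indices N. \<i> * complex_of_real (c \<nu>) * (if \<mu> = \<nu> then 2 ^ N else 0))"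
    unfolding sum_distrib_left[symmetric]
    using assms by (intro sum.cong refl) (auto simp: pauli_string_orthogonal pauli_indices_def)
  also have "\<dots> = (\<Sum>\<nu>\<in>pauli_indices N. if \<mu> = \<nu> then 2 ^ N * (\<i> * complex_of_real (c \<nu>)) else 0)"
    by (intro sum.cong refl) auto
  also have "\<dots> = (if \<mu> \<in> pauli_indices N then 2 ^ N * (\<i> * complex_of_real (c \<mu>)) else 0)"
    using finite_pauli_indices by simp
  finally show ?thesis .
qed

lemma pauli_coeff_comb: "\<mu> \<in> pauli_indices N \<Longrightarrow> pauli_coeff N \<mu> (pauli_comb N c) = c \<mu>"
  unfolding pauli_coeff_def by (subst pauli_comb_pairing) (auto simp: pauli_indices_def Im_power_real)

text \<open>The string of the zero index is the identity matrix.\<close>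

lemma trace_eq_pauli_pairing:
  "(\<Sum>i<2 ^ N. A $$ (i, i))
    = (\<Sum>i<2 ^ N. \<Sum>j<2 ^ N. pauli_string N (zero_index N) $$ (i, j) * A $$ (j, i))"
proof (rule sum.cong[OF refl])
  fix i :: nat assume i: "i \<in> {..<2 ^ N}"
  have "(\<Sum>j<2 ^ N. pauli_string N (zero_index N) $$ (i, j) * A $$ (j, i))
    = (\<Sum>j<2 ^ N. if i = j then A $$ (j, i) else 0)"
    using i by (intro sum.cong refl) (auto simp: pauli_string_zero_index)
  then show "A $$ (i, i) = (\<Sum>j<2 ^ N. pauli_string N (zero_index N) $$ (i, j) * A $$ (j, i))"
    using i by simp
qed

lemma pauli_comb_in_su: "pauli_comb N c \<in> carrier (su (2 ^ N))"
proof -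
  have "(\<Sum>i<2 ^ N. pauli_comb N c $$ (i, i)) = 0"
    unfolding trace_eq_pauli_pairing pauli_comb_pairing[OF zero_index_in]
    by (simp add: pauli_indices_def)
  moreover have "cnj (pauli_comb N c $$ (j, i)) = - pauli_comb N c $$ (i, j)"
    if "i < 2 ^ N" "j < 2 ^ N" for i j
    using that by (simp add: pauli_comb_def pauli_string_hermitian sum_negf)
  ultimately show ?thesis
    by (auto simp: su_carrier_iff) (auto simp: pauli_comb_def)
qed

text \<open>Completeness expands A over all Pauli strings. Skew-Hermitian symmetry makes the
  coefficients imaginary, and the vanishing trace removes the zero index.\<close>

lemma pauli_comb_coeff:
  assumes A: "A \<in> carrier (su (2 ^ N))"
  shows "pauli_comb N (\<lambda>\<mu>. pauli_coeff N \<mu> A) = A"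
proof (rule eq_matI)
  have A': "A \<in> carrier_mat (2 ^ N) (2 ^ N)" "(\<Sum>i<2 ^ N. A $$ (i, i)) = 0"
    and skew: "\<And>i j. i < 2 ^ N \<Longrightarrow> j < 2 ^ N \<Longrightarrow> cnj (A $$ (j, i)) = - A $$ (i, j)"
    using A by (auto simp: su_carrier_iff)
  define t where "t \<mu> = (\<Sum>i<2 ^ N. \<Sum>j<2 ^ N. pauli_string N \<mu> $$ (i, j) * A $$ (j, i))" for \<mu>
  have t_zero: "t (zero_index N) = 0"
    using A'(2) trace_eq_pauli_pairing[where A = A] by (simp add: t_def)
  have t_coeff: "\<i> * complex_of_real (pauli_coeff N \<mu> A) = t \<mu> / 2 ^ N" for \<mu>
  proof -
    \<comment> \<open>Conjugation transposes the Hermitian string, and transposes and negates A;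
      exchanging the two sums restores t up to sign. Hence t is imaginary and taking
      \<open>Im\<close> in the coefficient loses nothing.\<close>
    have "cnj (t \<mu>) = (\<Sum>i<2 ^ N. \<Sum>j<2 ^ N. - (pauli_string N \<mu> $$ (j, i) * A $$ (i, j)))"
      unfolding t_def cnj_sum by (intro sum.cong refl) (simp add: pauli_string_hermitian skew)
    also have "\<dots> = (\<Sum>i<2 ^ N. \<Sum>j<2 ^ N. - (pauli_string N \<mu> $$ (i, j) * A $$ (j, i)))"
      by (rule sum.swap)
    also have "\<dots> = - t \<mu>" by (simp add: t_def sum_negf)
    finally have "Re (t \<mu>) = 0" by (auto simp: complex_eq_iff)
    then have "t \<mu> = \<i> * complex_of_real (Im (t \<mu>))" by (simp add: complex_eq_iff)
    then show ?thesis by (simp add: pauli_coeff_def t_def)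
  qed
  fix k l assume "k < dim_row A" "l < dim_col A"
  then have kl: "k < 2 ^ N" "l < 2 ^ N" using A' by auto
  have "pauli_comb N (\<lambda>\<mu>. pauli_coeff N \<mu> A) $$ (k, l)
    = (\<Sum>\<mu>\<in>pauli_indices N. t \<mu> / 2 ^ N * pauli_string N \<mu> $$ (k, l))"
    using kl by (simp add: pauli_comb_def t_coeff)
  \<comment> \<open>The added summand at the zero index is a multiple of the trace of A.
    Completeness requires the sum over all indices.\<close>
  also have "\<dots> = (\<Sum>\<mu>\<in>all_indices N. t \<mu> / 2 ^ N * pauli_string N \<mu> $$ (k, l))"
    using finite_all_indices t_zero unfolding pauli_indices_def
    by (intro sum.mono_neutral_left) auto
  also have "\<dots> = (\<Sum>\<mu>\<in>all_indices N. t \<mu> * pauli_string N \<mu> $$ (k, l)) / 2 ^ N"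
    by (simp add: sum_divide_distrib)
  also have "(\<Sum>\<mu>\<in>all_indices N. t \<mu> * pauli_string N \<mu> $$ (k, l))
    = (\<Sum>\<mu>\<in>all_indices N. \<Sum>i<2 ^ N. \<Sum>j<2 ^ N.
        A $$ (j, i) * (pauli_string N \<mu> $$ (i, j) * pauli_string N \<mu> $$ (k, l)))"
    unfolding t_def sum_distrib_right by (intro sum.cong refl) (simp add: mult_ac)
  also have "\<dots> = (\<Sum>i<2 ^ N. \<Sum>\<mu>\<in>all_indices N. \<Sum>j<2 ^ N.
        A $$ (j, i) * (pauli_string N \<mu> $$ (i, j) * pauli_string N \<mu> $$ (k, l)))"
    by (rule sum.swap)
  also have "\<dots> = (\<Sum>i<2 ^ N. \<Sum>j<2 ^ N. \<Sum>\<mu>\<in>all_indices N.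
        A $$ (j, i) * (pauli_string N \<mu> $$ (i, j) * pauli_string N \<mu> $$ (k, l)))"
    by (intro sum.cong refl sum.swap)
  also have "\<dots> = (\<Sum>i<2 ^ N. \<Sum>j<2 ^ N. if j = k then (if i = l then 2 ^ N * A $$ (j, i) else 0) else 0)"
    unfolding sum_distrib_left[symmetric]
    by (intro sum.cong refl) (use kl in \<open>simp add: pauli_string_complete\<close>)
  also have "\<dots> = 2 ^ N * A $$ (k, l)"
    using kl by simp
  finally show "pauli_comb N (\<lambda>\<mu>. pauli_coeff N \<mu> A) $$ (k, l) = A $$ (k, l)" by simp
qed (use A in \<open>auto simp: su_carrier_iff pauli_comb_def\<close>)

lemma pauli_coeff_inject:
  assumes "A \<in> carrier (su (2 ^ N))" "B \<in> carrier (su (2 ^ N))"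
    and "\<And>\<mu>. \<mu> \<in> pauli_indices N \<Longrightarrow> pauli_coeff N \<mu> A = pauli_coeff N \<mu> B"
  shows "A = B"
proof -
  have "pauli_comb N (\<lambda>\<mu>. pauli_coeff N \<mu> A) = pauli_comb N (\<lambda>\<mu>. pauli_coeff N \<mu> B)"
    unfolding pauli_comb_def by (intro cong_mat refl) (simp add: assms(3))
  then show ?thesis using assms(1,2) by (simp add: pauli_comb_coeff)
qed

lemma smult_pauli_string_eq_comb:
  assumes "\<nu> \<in> pauli_indices N"
  shows "\<i> \<cdot>\<^sub>m pauli_string N \<nu> = pauli_comb N (\<lambda>\<mu>. if \<mu> = \<nu> then 1 else 0)"
proof (rule eq_matI)
  fix k l assume "k < dim_row (pauli_comb N (\<lambda>\<mu>. if \<mu> = \<nu> then 1 else 0))"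
    "l < dim_col (pauli_comb N (\<lambda>\<mu>. if \<mu> = \<nu> then 1 else 0))"
  then have kl: "k < 2 ^ N" "l < 2 ^ N" by (auto simp: pauli_comb_def)
  have "(\<Sum>\<mu>\<in>pauli_indices N. \<i> * complex_of_real (if \<mu> = \<nu> then 1 else 0) * pauli_string N \<mu> $$ (k, l))
    = (\<Sum>\<mu>\<in>pauli_indices N. if \<mu> = \<nu> then \<i> * pauli_string N \<mu> $$ (k, l) else 0)"
    by (intro sum.cong refl) auto
  then show "(\<i> \<cdot>\<^sub>m pauli_string N \<nu>) $$ (k, l) = pauli_comb N (\<lambda>\<mu>. if \<mu> = \<nu> then 1 else 0) $$ (k, l)"
    using kl assms finite_pauli_indices pauli_string_carrier[of N \<nu>] by (simp add: pauli_comb_def)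
qed (use pauli_string_carrier[of N \<nu>] in \<open>auto simp: pauli_comb_def\<close>)

lemma pauli_comb_cong:
  "(\<And>\<mu>. \<mu> \<in> pauli_indices N \<Longrightarrow> c \<mu> = d \<mu>) \<Longrightarrow> pauli_comb N c = pauli_comb N d"
  unfolding pauli_comb_def by (intro cong_mat refl) simp

lemma pauli_comb_add: "pauli_comb N (\<lambda>\<mu>. c \<mu> + d \<mu>) = pauli_comb N c + pauli_comb N d"
  by (rule eq_matI) (auto simp: pauli_comb_def sum.distrib distrib_left distrib_right)

lemma pauli_comb_smult: "pauli_comb N (\<lambda>\<mu>. r * c \<mu>) = complex_of_real r \<cdot>\<^sub>m pauli_comb N c"
  by (rule eq_matI) (auto simp: pauli_comb_def sum_distrib_left mult_ac)

section \<open>The permutation action in coordinates\<close>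

lemma su_hom_eqI:
  assumes f: "f \<in> module_hom class_ring (su (2 ^ N)) (su (2 ^ N))"
    and g: "g \<in> module_hom class_ring (su (2 ^ N)) (su (2 ^ N))"
    and eq: "\<And>\<nu>. \<nu> \<in> pauli_indices N \<Longrightarrow> f (\<i> \<cdot>\<^sub>m pauli_string N \<nu>) = g (\<i> \<cdot>\<^sub>m pauli_string N \<nu>)"
    and A: "A \<in> carrier (su (2 ^ N))"
  shows "f A = g A"
proof -
  let ?S = "carrier (su (2 ^ N))"
  have add: "h (A + B) = h A + h B" if "h \<in> module_hom class_ring (su (2 ^ N)) (su (2 ^ N))" "A \<in> ?S" "B \<in> ?S" for h A B
    using module_hom_add[OF that] by (simp add: su_simps)
  have smult: "h (complex_of_real r \<cdot>\<^sub>m A) = complex_of_real r \<cdot>\<^sub>m h A"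
    if "h \<in> module_hom class_ring (su (2 ^ N)) (su (2 ^ N))" "A \<in> ?S" for h r A
    using module_hom_smult[OF that(1) _ that(2), of r] by (simp add: su_simps)
  \<comment> \<open>Linearity is applied by induction on the set T of indices whose coefficients are
    kept; taking T to be all nonzero indices recovers A.\<close>
  have "f (pauli_comb N (\<lambda>\<mu>. if \<mu> \<in> T then c \<mu> else 0)) = g (pauli_comb N (\<lambda>\<mu>. if \<mu> \<in> T then c \<mu> else 0))"
    if "finite T" "T \<subseteq> pauli_indices N" for T c
    using that
  proof (induction T)
    case empty
    let ?Z = "pauli_comb N (\<lambda>\<mu>. 0)"
    have null: "complex_of_real 0 \<cdot>\<^sub>m B = 0\<^sub>m (2 ^ N) (2 ^ N)" if "B \<in> ?S" for B
      using that by (intro eq_matI) (auto simp: su_carrier_iff)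
    have hZ: "h ?Z = 0\<^sub>m (2 ^ N) (2 ^ N)"
      if h: "h \<in> module_hom class_ring (su (2 ^ N)) (su (2 ^ N))" for h
    proof -
      have "h ?Z = h (complex_of_real 0 \<cdot>\<^sub>m ?Z)"
        by (simp only: pauli_comb_smult[symmetric] mult_zero_left)
      also have "\<dots> = complex_of_real 0 \<cdot>\<^sub>m h ?Z" by (rule smult[OF h pauli_comb_in_su])
      also have "\<dots> = 0\<^sub>m (2 ^ N) (2 ^ N)"
        using module_hom_closed[OF h] pauli_comb_in_su by (intro null) blast
      finally show ?thesis .
    qed
    from hZ[OF f] hZ[OF g] show ?case by simp
  next
    case (insert \<nu> T)
    then have \<nu>: "\<nu> \<in> pauli_indices N" by simp
    have split: "pauli_comb N (\<lambda>\<mu>. if \<mu> \<in> insert \<nu> T then c \<mu> else 0)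
      = complex_of_real (c \<nu>) \<cdot>\<^sub>m (\<i> \<cdot>\<^sub>m pauli_string N \<nu>) + pauli_comb N (\<lambda>\<mu>. if \<mu> \<in> T then c \<mu> else 0)"
      unfolding smult_pauli_string_eq_comb[OF \<nu>] pauli_comb_smult[symmetric] pauli_comb_add[symmetric]
      using insert by (intro pauli_comb_cong) auto
    have in_su: "\<i> \<cdot>\<^sub>m pauli_string N \<nu> \<in> ?S"
      unfolding smult_pauli_string_eq_comb[OF \<nu>] by (rule pauli_comb_in_su)
    then have in_su': "complex_of_real (c \<nu>) \<cdot>\<^sub>m (\<i> \<cdot>\<^sub>m pauli_string N \<nu>) \<in> ?S"
      unfolding smult_pauli_string_eq_comb[OF \<nu>] pauli_comb_smult[symmetric] by (intro pauli_comb_in_su)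
    show ?case unfolding split
      using insert f g in_su in_su' \<nu> by (simp add: add smult eq pauli_comb_in_su)
  qed
  from this[OF finite_pauli_indices subset_refl, of "\<lambda>\<mu>. pauli_coeff N \<mu> A"]
  show ?thesis
    using A pauli_comb_coeff[OF A]
      pauli_comb_cong[of N "\<lambda>\<mu>. if \<mu> \<in> pauli_indices N then pauli_coeff N \<mu> A else 0" "\<lambda>\<mu>. pauli_coeff N \<mu> A"]
    by simp
qed

text \<open>The right-hand side is linear in A and carries the basis vector at \<nu> to the one at
  \<nu> \<circ> \<alpha>, so the choice in \<open>rho\<close> has a witness. By
  \<open>su_hom_eqI\<close> every admissible choice agrees with it on su. The inverse appears
  because coefficients are pulled back where basis vectors are pushed forward.\<close>

lemma rho_eq:
  assumes \<alpha>: "\<alpha> permutes {1..N}" and A: "A \<in> carrier (su (2 ^ N))"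
  shows "rho N \<alpha> A = pauli_comb N (\<lambda>\<mu>. pauli_coeff N (\<mu> \<circ> inv' \<alpha>) A)"
proof -
  define f where "f A = pauli_comb N (\<lambda>\<mu>. pauli_coeff N (\<mu> \<circ> inv' \<alpha>) A)" for A
  let ?P = "\<lambda>f. f \<in> module_hom class_ring (su (2 ^ N)) (su (2 ^ N)) \<and>
        (\<forall>\<mu>\<in>pauli_indices N. f (\<i> \<cdot>\<^sub>m pauli_string N \<mu>) = \<i> \<cdot>\<^sub>m pauli_string N (\<mu> \<circ> \<alpha>))"
  have "f \<in> module_hom class_ring (su (2 ^ N)) (su (2 ^ N))"
    using su_carrier by (auto simp: module_hom_def f_def pauli_comb_in_su su_simps pauli_coeff_add
        pauli_coeff_smult pauli_comb_add pauli_comb_smult)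
  moreover have "f (\<i> \<cdot>\<^sub>m pauli_string N \<nu>) = \<i> \<cdot>\<^sub>m pauli_string N (\<nu> \<circ> \<alpha>)" if \<nu>: "\<nu> \<in> pauli_indices N" for \<nu>
    unfolding f_def smult_pauli_string_eq_comb[OF \<nu>]
      smult_pauli_string_eq_comb[OF pauli_indices_comp_permutes[OF \<nu> \<alpha>]]
    by (intro pauli_comb_cong)
      (simp add: pauli_coeff_comb pauli_indices_comp_permutes permutes_inv[OF \<alpha>] comp_permutes_eq_iff[OF \<alpha>])
  ultimately have f: "?P f" by blast
  then have rho: "?P (rho N \<alpha>)" unfolding rho_def by (rule someI[of ?P])
  have "rho N \<alpha> A = f A"
    by (rule su_hom_eqI[OF _ _ _ A]) (use f rho in auto)
  then show ?thesis by (simp add: f_def)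
qed

text \<open>Substituting \<mu> \<circ> \<alpha> for \<mu> in \<open>rho_eq\<close> replaces the
  inverse by \<alpha> itself.\<close>

lemma rho_fixed_iff:
  assumes \<alpha>: "\<alpha> permutes {1..N}" and A: "A \<in> carrier (su (2 ^ N))"
  shows "rho N \<alpha> A = A \<longleftrightarrow> (\<forall>\<mu>\<in>pauli_indices N. pauli_coeff N (\<mu> \<circ> \<alpha>) A = pauli_coeff N \<mu> A)"
proof
  assume fixed: "rho N \<alpha> A = A"
  show "\<forall>\<mu>\<in>pauli_indices N. pauli_coeff N (\<mu> \<circ> \<alpha>) A = pauli_coeff N \<mu> A"
  proof
    fix \<mu> assume \<mu>: "\<mu> \<in> pauli_indices N"
    have "pauli_coeff N (\<mu> \<circ> \<alpha>) A = pauli_coeff N (\<mu> \<circ> \<alpha>) (rho N \<alpha> A)" by (simp add: fixed)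
    also have "\<dots> = pauli_coeff N (\<mu> \<circ> \<alpha> \<circ> inv' \<alpha>) A"
      using pauli_indices_comp_permutes[OF \<mu> \<alpha>] by (simp add: rho_eq[OF \<alpha> A] pauli_coeff_comb)
    also have "\<mu> \<circ> \<alpha> \<circ> inv' \<alpha> = \<mu>" using comp_permutes_eq_iff[OF \<alpha>] by blast
    finally show "pauli_coeff N (\<mu> \<circ> \<alpha>) A = pauli_coeff N \<mu> A" .
  qed
next
  assume inv: "\<forall>\<mu>\<in>pauli_indices N. pauli_coeff N (\<mu> \<circ> \<alpha>) A = pauli_coeff N \<mu> A"
  show "rho N \<alpha> A = A"
    unfolding rho_eq[OF \<alpha> A]
  proof (rule pauli_coeff_inject[OF pauli_comb_in_su A])
    fix \<mu> assume \<mu>: "\<mu> \<in> pauli_indices N"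
    then have "pauli_coeff N (\<mu> \<circ> inv' \<alpha> \<circ> \<alpha>) A = pauli_coeff N (\<mu> \<circ> inv' \<alpha>) A"
      using inv pauli_indices_comp_permutes[OF \<mu> permutes_inv[OF \<alpha>]] by blast
    moreover have "\<mu> \<circ> inv' \<alpha> \<circ> \<alpha> = \<mu>" using comp_permutes_eq_iff[OF \<alpha>] by metis
    ultimately show "pauli_coeff N \<mu> (pauli_comb N (\<lambda>\<mu>. pauli_coeff N (\<mu> \<circ> inv' \<alpha>) A)) = pauli_coeff N \<mu> A"
      using \<mu> by (simp add: pauli_coeff_comb)
  qed
qed

text \<open>Invariant elements are those whose coefficients are constant on the orbits. The
  coefficient at one representative per orbit therefore serves as a system of coordinates for
  \<open>dim_eq_card_coordinates\<close>.\<close>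

lemma real_dim_Gsu:
  assumes "perm_group {1..N} G"
  shows "real_dim (Gsu G N) = card (pauli_indices N // orbit_rel G (pauli_indices N))"
proof -
  interpret perm_group "{1..N}" G by fact
  let ?I = "pauli_indices N" and ?S = "carrier (su (2 ^ N))"
  let ?R = "orbit_rel G ?I"
  define C where "C = {A \<in> ?S. \<forall>\<alpha>\<in>G. \<forall>\<mu>\<in>?I. pauli_coeff N (\<mu> \<circ> \<alpha>) A = pauli_coeff N \<mu> A}"
  have Gsu: "Gsu G N = (su (2 ^ N))\<lparr>carrier := C\<rparr>"
    unfolding Gsu_def C_def using rho_fixed_iff permutes by (intro arg_cong2[where f = "\<lambda>A. carrier_update A"]) auto
  have equiv: "equiv ?I ?R" by (rule equiv_orbit_rel)
  have "(\<forall>\<alpha>\<in>G. \<forall>\<mu>\<in>?I. pauli_coeff N (\<mu> \<circ> \<alpha>) A = pauli_coeff N \<mu> A)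
    \<longleftrightarrow> (\<forall>(\<mu>, \<nu>)\<in>?R. pauli_coeff N \<mu> A = pauli_coeff N \<nu> A)" (is "?inv \<longleftrightarrow> ?const") for A
  proof
    assume ?inv
    then show ?const by (auto simp: orbit_rel_def simp del: comp_apply)
  next
    assume const: ?const
    show ?inv
    proof (intro ballI)
      fix \<alpha> \<mu> assume "\<alpha> \<in> G" "\<mu> \<in> ?I"
      then have "(\<mu>, \<mu> \<circ> \<alpha>) \<in> ?R"
        using pauli_indices_comp_permutes[of \<mu> N \<alpha>] permutes by (auto simp: orbit_rel_def)
      with const show "pauli_coeff N (\<mu> \<circ> \<alpha>) A = pauli_coeff N \<mu> A" by auto
    qed
  qed
  then have C_iff: "A \<in> C \<longleftrightarrow> A \<in> ?S \<and> (\<forall>(\<mu>, \<nu>)\<in>?R. pauli_coeff N \<mu> A = pauli_coeff N \<nu> A)" for A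
    by (simp add: C_def)
  have C_D: "pauli_coeff N \<mu> A = pauli_coeff N \<nu> A" if "A \<in> C" "(\<mu>, \<nu>) \<in> ?R" for A \<mu> \<nu>
    using that by (auto simp: C_iff)
  have comb_C: "pauli_comb N c \<in> C \<longleftrightarrow> (\<forall>(\<mu>, \<nu>)\<in>?R. c \<mu> = c \<nu>)" for c
    unfolding C_iff by (auto simp: orbit_rel_def pauli_comb_in_su pauli_coeff_comb)
  have carrier: "A \<in> carrier_mat (2 ^ N) (2 ^ N)" if "A \<in> C" for A
    using that by (auto simp: C_iff su_carrier_iff)
  have C_comb: "pauli_comb N (\<lambda>\<mu>. pauli_coeff N \<mu> A) = A" if "A \<in> C" for A
    using that pauli_comb_coeff by (simp add: C_iff)
  have add: "A + B \<in> C" if "A \<in> C" "B \<in> C" for A B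
  proof -
    have "pauli_comb N (\<lambda>\<mu>. pauli_coeff N \<mu> A + pauli_coeff N \<mu> B) \<in> C"
      using that unfolding comb_C by (fastforce simp: C_iff)
    then show ?thesis using that by (simp add: pauli_comb_add C_comb)
  qed
  have smult: "complex_of_real r \<cdot>\<^sub>m A \<in> C" if "A \<in> C" for r A
  proof -
    have "pauli_comb N (\<lambda>\<mu>. r * pauli_coeff N \<mu> A) \<in> C"
      using that unfolding comb_C by (auto simp: C_iff)
    then show ?thesis using that by (simp add: pauli_comb_smult C_comb)
  qed
  \<comment> \<open>The zero matrix is exhibited as a multiple of an invariant element.\<close>
  have "complex_of_real 0 \<cdot>\<^sub>m pauli_comb N (\<lambda>_. 0) \<in> C"
    by (rule smult) (auto simp: comb_C)
  also have "complex_of_real 0 \<cdot>\<^sub>m pauli_comb N (\<lambda>_. 0) = 0\<^sub>m (2 ^ N) (2 ^ N)"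
    by (rule eq_matI) (auto simp: pauli_comb_def)
  finally have "vectorspace class_ring (Gsu G N)"
    unfolding Gsu using add smult by (intro vectorspace_su_subset) (auto simp: C_def)
  moreover define rep :: "(nat \<Rightarrow> nat) set \<Rightarrow> nat \<Rightarrow> nat" where "rep K = (SOME \<mu>. \<mu> \<in> K)" for K
  have rep: "(\<mu>, rep (?R `` {\<mu>})) \<in> ?R" if "\<mu> \<in> ?I" for \<mu>
    unfolding rep_def using someI[of "\<lambda>\<nu>. \<nu> \<in> ?R `` {\<mu>}" \<mu>] equiv_class_self[OF equiv that] by blast
  have "finite (?I // ?R)"
    using finite_pauli_indices equiv by (intro finite_quotient) (auto simp: equiv_def)
  ultimately show ?thesis
  proof (rule dim_eq_card_coordinates[where \<kappa> = "\<lambda>K. pauli_coeff N (rep K)"])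
    fix A B assume "A \<in> carrier (Gsu G N)" "B \<in> carrier (Gsu G N)"
    then have AB: "A \<in> C" "B \<in> C" by (auto simp: Gsu)
    assume eq: "\<And>K. K \<in> ?I // ?R \<Longrightarrow> pauli_coeff N (rep K) A = pauli_coeff N (rep K) B"
    have "pauli_coeff N \<mu> A = pauli_coeff N \<mu> B" if "\<mu> \<in> ?I" for \<mu>
      using eq[OF quotientI[OF that]] C_D[OF AB(1) rep[OF that]] C_D[OF AB(2) rep[OF that]] by simp
    with AB show "A = B" by (intro pauli_coeff_inject) (auto simp: C_iff)
  next
    fix c
    \<comment> \<open>Prescribed values on the orbits are realized by giving each index the value of
      its orbit.\<close>
    have "pauli_comb N (\<lambda>\<mu>. c (?R `` {\<mu>})) \<in> C"
      unfolding comb_C using equiv_class_eq[OF equiv] by auto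
    moreover have "pauli_coeff N (rep K) (pauli_comb N (\<lambda>\<mu>. c (?R `` {\<mu>}))) = c K" if "K \<in> ?I // ?R" for K
    proof -
      from that obtain \<mu> where \<mu>: "\<mu> \<in> ?I" "K = ?R `` {\<mu>}" by (auto elim: quotientE)
      have r: "(\<mu>, rep K) \<in> ?R" using rep[OF \<mu>(1)] \<mu>(2) by simp
      then have "rep K \<in> ?I" by (simp add: orbit_rel_def)
      then have "pauli_coeff N (rep K) (pauli_comb N (\<lambda>\<mu>. c (?R `` {\<mu>}))) = c (?R `` {rep K})"
        by (rule pauli_coeff_comb)
      also have "?R `` {rep K} = K" using equiv_class_eq[OF equiv r] \<mu>(2) by simp
      finally show ?thesis .
    qed
    ultimately show "\<exists>A\<in>carrier (Gsu G N). \<forall>K\<in>?I // ?R. pauli_coeff N (rep K) A = c K"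
      by (auto simp: Gsu)
  qed (auto simp: Gsu su_simps carrier pauli_coeff_add pauli_coeff_smult)
qed

section \<open>Dimensions\<close>

lemma Z_S_const_4: "Z_S N (\<lambda>_. 4) = real ((N + 3) choose 3)"
proof (induction N rule: less_induct)
  case (less N)
  show ?case
  proof (cases "N = 0")
    case True
    then show ?thesis by (simp add: Z_S.simps)
  next
    case False
    have "(\<Sum>l = 1..N. 4 * Z_S (N - l) (\<lambda>_. 4)) = (\<Sum>m<N. 4 * Z_S m (\<lambda>_. 4))"
      by (rule sum.reindex_bij_witness[where i = "\<lambda>m. N - m" and j = "\<lambda>l. N - l"]) auto
    also have "\<dots> = 4 * real (\<Sum>m<N. (m + 3) choose 3)"
      using less by (simp add: sum_distrib_left)
    \<comment> \<open>The terms with k < 3 vanish, so the shifted sum takes the form of the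
      hockey-stick identity.\<close>
    also have "(\<Sum>m<N. (m + 3) choose 3) = (\<Sum>k\<le>N + 2. k choose 3)"
    proof -
      have "(\<Sum>k\<in>{..N + 2}. k choose 3) = (\<Sum>k\<in>{3..<N + 3}. k choose 3)"
        by (rule sum.mono_neutral_right) auto
      also have "\<dots> = (\<Sum>m<N. (m + 3) choose 3)"
        using sum.shift_bounds_nat_ivl[of "\<lambda>k. k choose 3" 0 3 N] by (simp add: atLeast0LessThan)
      finally show ?thesis by simp
    qed
    also have "\<dots> = (N + 3) choose 4"
    proof -
      have "Suc (N + 2) = N + 3" "Suc 3 = (4 :: nat)" by simp_all
      then show ?thesis using sum_choose_upper[of 3 "N + 2"] by metis
    qed
    \<comment> \<open>Absorption produces the factor N that cancels the 1 / N of the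
      recursion.\<close>
    also have "4 * real ((N + 3) choose 4) = real N * real ((N + 3) choose 3)"
    proof -
      have "4 * ((N + 3) choose 4) = N * ((N + 3) choose 3)"
        using binomial_absorb_comp[of "N + 3" 3] binomial_absorption[of 3 "N + 3"] by simp
      then show ?thesis by (metis of_nat_mult of_nat_numeral)
    qed
    finally show ?thesis using False by (subst Z_S.simps) simp
  qed
qed

text \<open>With these signs the recursion is Newton's identity for elementary symmetric functions,
  here of four variables equal to 1, whose power sums are all 4.\<close>

lemma Z_S_alternating_4: "Z_S N (\<lambda>i. (- 1) ^ (i - 1) * 4) = real (4 choose N)"
proof (induction N rule: less_induct)
  case (less N)
  show ?case
  proof (cases N)
    case 0
    then show ?thesis by (simp add: Z_S.simps)
  next
    case (Suc n)
    have "(\<Sum>l = 1..N. (- 1) ^ (l - 1) * 4 * Z_S (N - l) (\<lambda>i. (- 1) ^ (i - 1) * 4))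
      = (\<Sum>m\<le>n. (- 1) ^ (n - m) * 4 * Z_S m (\<lambda>i. (- 1) ^ (i - 1) * 4))"
      by (rule sum.reindex_bij_witness[where i = "\<lambda>m. N - m" and j = "\<lambda>l. N - l"]) (auto simp: Suc One_nat_def)
    \<comment> \<open>Splitting the sign leaves an alternating partial sum of binomial coefficients,
      which closes up to \<open>3 gchoose n\<close>.\<close>
    also have "\<dots> = (\<Sum>m\<le>n. 4 * (- 1) ^ n * ((4 gchoose m) * (- 1) ^ m))"
    proof (rule sum.cong[OF refl])
      fix m assume m: "m \<in> {..n}"
      have "(- 1 :: real) ^ (n - m) = (- 1) ^ n * (- 1) ^ m"
        using m by (auto simp: minus_one_power_iff even_diff_nat)
      then show "(- 1) ^ (n - m) * 4 * Z_S m (\<lambda>i. (- 1) ^ (i - 1) * 4) = 4 * (- 1) ^ n * ((4 gchoose m) * (- 1) ^ m)"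
        using less m Suc by (simp add: binomial_gbinomial)
    qed
    also have "\<dots> = 4 * (- 1) ^ n * ((- 1) ^ n * (3 gchoose n))"
      using gbinomial_sum_lower_neg[of "4 :: real" n] by (simp add: sum_distrib_left[symmetric])
    also have "\<dots> = 4 * real (3 choose n)"
      by (simp add: power_mult_distrib[symmetric] binomial_gbinomial)
    also have "\<dots> = real N * real (4 choose N)"
    proof -
      have "4 * (3 choose n) = N * (4 choose N)"
        using Suc_times_binomial[of n 3] by (simp add: Suc)
      then show ?thesis by (metis of_nat_mult of_nat_numeral)
    qed
    finally show ?thesis using Suc by (subst Z_S.simps) simp
  qed
qed

section \<open>From orbit counts to dimensions\<close>

lemma all_indices_comp: "perm_group {1..N} G \<Longrightarrow> \<mu> \<in> all_indices N \<Longrightarrow> g \<in> G \<Longrightarrow> \<mu> \<circ> g \<in> all_indices N"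
  by (rule PiE_comp_permutes) (auto simp: perm_group_def)

lemma finite_perm_group:
  assumes "perm_group X G" "finite X"
  shows "finite G"
  by (rule finite_subset[OF _ finite_permutations[OF assms(2)]]) (use assms in \<open>auto simp: perm_group_def\<close>)

lemma real_dim_Gsu_orbits:
  assumes "perm_group {1..N} G"
  shows "real (real_dim (Gsu G N)) = real (card (all_indices N // orbit_rel G (all_indices N))) - 1"
  using real_dim_Gsu[OF assms] card_orbits_nonzero[OF assms] by simp

text \<open>Here z is the average number of fixed maps, which by Burnside's lemma is the number of
  orbits on all indices.\<close>

lemma real_dim_Gsu_burnside:
  assumes G: "perm_group {1..N} G"
    and sum: "real (\<Sum>g\<in>G. card {\<mu> \<in> all_indices N. \<mu> \<circ> g = \<mu>}) = real (card G) * z"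
  shows "real (real_dim (Gsu G N)) = z - 1"
proof -
  have fin: "finite G" using finite_perm_group[OF G] by simp
  have "G \<noteq> {}" using G by (auto simp: perm_group_def)
  then have "card G > 0" using fin by (simp add: card_gt_0_iff)
  moreover have "real (card (all_indices N // orbit_rel G (all_indices N))) * real (card G) = real (card G) * z"
    unfolding sum[symmetric] of_nat_mult[symmetric]
    by (subst perm_group.burnside[OF G fin finite_all_indices all_indices_comp[OF G]]) simp_all
  ultimately show ?thesis using real_dim_Gsu_orbits[OF G] by simp
qed

theorem theorem4p6:
  fixes N :: nat
  assumes "N \<ge> 1"
  shows "real (real_dim (Gsu (S_grp N) N)) = Z_S N (\<lambda>_. 4) - 1
    \<and> (N \<ge> 2 \<longrightarrow> real (real_dim (Gsu (A_grp N) N)) = Z_A N (\<lambda>_. 4) - 1)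
    \<and> real (real_dim (Gsu (D_grp N) N)) = Z_D N (\<lambda>_. 4) - 1
    \<and> real (real_dim (Gsu (C_grp N) N)) = Z_C N (\<lambda>_. 4) - 1
    \<and> real (real_dim (Gsu (E_grp N) N)) = Z_E N (\<lambda>_. 4) - 1"
proof (intro conjI impI)
  \<comment> \<open>The number of multisets of size N over the four Pauli labels, brought to the
    form of \<open>Z_S_const_4\<close>.\<close>
  have choose: "(4 + N - 1) choose N = (N + 3) choose 3"
    using binomial_symmetric[of 3 "N + 3"] by (simp add: add.commute)
  have S: "S_grp N = {p. p permutes {1..N}}" by (simp add: S_grp_def sym_group_def)
  show "real (real_dim (Gsu (S_grp N) N)) = Z_S N (\<lambda>_. 4) - 1"
    unfolding S real_dim_Gsu_orbits[OF perm_group_Sym] using choose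
    by (simp add: card_orbits_Sym Z_S_const_4)
  have A: "A_grp N = {p. p permutes {1..N} \<and> evenperm p}" by (simp add: A_grp_def alt_group_def)
  show "real (real_dim (Gsu (A_grp N) N)) = Z_A N (\<lambda>_. 4) - 1" if "N \<ge> 2"
    unfolding A real_dim_Gsu_orbits[OF perm_group_Alt[OF finite_atLeastAtMost]] using choose that
    by (simp add: card_orbits_Alt Z_A_def Z_S_const_4 Z_S_alternating_4)
  have cardC: "card (C_grp N) = N"
    unfolding C_grp_eq using card_image[OF inj_rotation[OF assms]] by simp
  show C: "real (real_dim (Gsu (C_grp N) N)) = Z_C N (\<lambda>_. 4) - 1"
    using sum_fixed_C[OF assms] by (intro real_dim_Gsu_burnside perm_group_C assms) (simp add: cardC)
  show "real (real_dim (Gsu (D_grp N) N)) = Z_D N (\<lambda>_. 4) - 1"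
  \<comment> \<open>Only from N = 3 on are the N reflections distinct from the rotations; the
    smaller cases reduce to the cyclic group.\<close>
  proof (cases "N \<ge> 3")
    case True
    let ?f = "\<lambda>g. card {\<mu> \<in> all_indices N. \<mu> \<circ> g = \<mu>}"
    have fin: "finite (C_grp N)" "finite (reflection N ` {..<N})" by (simp_all add: C_grp_eq)
    note disj = C_reflection_disjoint[OF True]
    have "card (D_grp N) = 2 * N"
      unfolding D_grp_eq using card_Un_disjoint[OF fin disj] card_image[OF inj_reflection[OF assms]] cardC by simp
    moreover have "sum ?f (D_grp N) = sum ?f (C_grp N) + (\<Sum>k<N. ?f (reflection N k))"
      unfolding D_grp_eq sum.union_disjoint[OF fin disj] sum.reindex[OF inj_reflection[OF assms]] by simp
    \<comment> \<open>The two \<open>Z_C\<close> terms cancel, which leaves the group order 2 * N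
      times \<open>Z_D\<close>.\<close>
    then have "real (sum ?f (D_grp N)) = real N * Z_C N (\<lambda>_. 4) + real N * (2 * Z_D N (\<lambda>_. 4) - Z_C N (\<lambda>_. 4))"
      by (simp only: of_nat_add sum_fixed_C[OF assms] sum_fixed_reflections[OF assms])
    ultimately show ?thesis
      by (intro real_dim_Gsu_burnside perm_group_D assms) (simp add: algebra_simps)
  next
    case False
    then have "N = 1 \<or> N = 2" using assms by auto
    then show ?thesis using C D_grp_small Z_D_small by metis
  qed
  have "perm_group {1..N} (E_grp N)"
    by unfold_locales (auto simp: E_grp_def permutes_id)
  then show "real (real_dim (Gsu (E_grp N) N)) = Z_E N (\<lambda>_. 4) - 1"
    by (rule real_dim_Gsu_burnside) (simp add: E_grp_def Z_E_def card_funcsetE)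
qed

end
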